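(* Let $\mathscr{G}$ be a separable Banach-Lie group with identity $e$, and let $x=(x^s_t)_{0\le s\le t<\infty}$ be a multiplicative process in $\mathscr{G}$ with càdlàg paths (with respect to an additive filtration satisfying the usual hypotheses on a complete probability space). Suppose that $x$ has bounded jumps. Then for all $0<r<u$, all $\alpha\in\mathbb{R}$ and every open set $V\subseteq\mathscr{G}$ containing $e$, $$\mathbb{E}\Bigl(\sup_{r\le s\le t\le u}\mathrm{e}^{\alpha\,\inf\{m:\;x^s_t\in V^m\}}\Bigr)<\infty .$$
   Context: A Banach-Lie group $\mathscr{G}$ is a group with identity $e$ that is also a Banach manifold (smooth in the Fréchet sense), with smooth multiplication and inversion; its Lie algebra is the Banach space $\mathfrak{g}=T_e\mathscr{G}$ with norm $\|\cdot\|$. The exponential map $\exp:\mathfrak{g}\to\mathscr{G}$ restricts to a diffeomorphism from an open neighbourhood $U_{\mathfrak{g}}$ of $0$ onto an open neighbourhood $U_{\mathscr{G}}$ of $e$ (both fixed); its inverse there is $\log$, with $\operatorname{dom}(\log)=U_{\mathscr{G}}$. Write $B_\delta=\{G\in\mathfrak{g}:\|G\|<\delta\}$ and $U_\delta=\exp(B_\delta)$. For an open set $V\ni e$: $V^0=\{e\}$ and $V^m=\{g_1\cdots g_m: g_1,\dots,g_m\in V\}$. An additive filtration is a family of $\sigma$-algebras $\mathscr{F}^s_t\subseteq\mathscr{F}$, $0\le s\le t<\infty$, such that for all $s\le t\le u\le v$: $\mathscr{F}^s_t$ and $\mathscr{F}^u_v$ are independent, and $\mathscr{F}^t_u\subseteq\mathscr{F}^s_v$.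 Usual hypotheses: for fixed $s$, $(\mathscr{F}^s_t)_{t\ge s}$ is right-continuous in $t$, and every $\mathscr{F}^s_t$ is complete. A two-parameter process $x=(x^s_t)_{0\le s\le t<\infty}$ of random elements of $\mathscr{G}$ is a multiplicative process with respect to $(\mathscr{F}^s_t)_{s\le t}$ if: (1) $x^s_t$ is $\mathscr{F}^s_t$-measurable for all $s\le t$; (2) $x^s_s=e$ and $x^s_tx^t_u=x^s_u$ almost surely for all $s\le t\le u$; (3) $x$ is stochastically continuous, i.e. for all $s\le t$ and every open $U\ni e$, $\lim_{h,k\to0}\mathbb{P}((x^s_t)^{-1}x^{s+h}_{t+k}\in U)=1$ (any signs of $h,k$ with $0\le s+h\le t+k$). Càdlàg paths means càdlàg in both arguments simultaneously: $(s,t)\mapsto x^s_t(\omega)$ is jointly right-continuous on $\{s\le t\}$ and has joint one-sided limits (each argument approached from the left or from the right). Write $x_t=x^0_t$ and $x^{t-}_t=\lim_{s\nearrow t}x^s_t=(x_{t-})^{-1}x_t$, with the convention $x^{0-}_0=e$. The process $x$ has bounded jumps if there are $\delta>0$ with $U_\delta\subseteq\operatorname{dom}(\log)$ and $n\in\mathbb{N}$ such that $\mathbb{P}(\forall t\ge0:\ x^{t-}_t\in(U_\delta)^n)=1$. *)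

theory Defs
  imports "HOL-Probability.Probability"
begin

section \<open>Smooth maps between Banach spaces\<close>

definition bounded_multilinear ::
  "nat \<Rightarrow> ('a::real_normed_vector list \<Rightarrow> 'b::real_normed_vector) \<Rightarrow> bool" where
  "bounded_multilinear k T \<longleftrightarrow>
     (\<forall>vs i. length vs = k \<and> i < k \<longrightarrow> linear (\<lambda>v. T (vs[i := v]))) \<and>
     (\<exists>K. \<forall>vs. length vs = k \<longrightarrow> norm (T vs) \<le> K * prod_list (map norm vs))"

text \<open>
  Infinite Frechet differentiability on an open set. HOL has no type containing all the iterated
  spaces \<open>L(E, L(E, \<dots> F))\<close>, so the derivatives of every order are carried by one function:
  \<open>D x [v\<^sub>1, \<dots>, v\<^sub>k]\<close> is the \<open>k\<close>-th derivative at \<open>x\<close>, a bounded \<open>k\<close>-linear map, under the usual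
  isometry of \<open>L(E, L\<^sup>k(E; F))\<close> with \<open>L\<^sup>k\<^sup>+\<^sup>1(E; F)\<close>. The last clause says that the derivative of
  order \<open>k + 1\<close> is the Frechet derivative of the one of order \<open>k\<close>, with respect to the operator norm
  on \<open>k\<close>-linear maps (the estimate is uniform in \<open>vs\<close>).
\<close>

definition smooth_on ::
  "'a::real_normed_vector set \<Rightarrow> ('a \<Rightarrow> 'b::real_normed_vector) \<Rightarrow> bool" where
  "smooth_on S f \<longleftrightarrow>
     (\<exists>D. (\<forall>x\<in>S. D x [] = f x) \<and>
          (\<forall>k. \<forall>x\<in>S. bounded_multilinear k (D x)) \<and>
          (\<forall>k. \<forall>x\<in>S. \<forall>\<epsilon>>0. \<forall>\<^sub>F y in at x within S. \<forall>vs. length vs = k \<longrightarrow>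
             norm (D y vs - D x vs - D x ((y - x) # vs))
               \<le> \<epsilon> * norm (y - x) * prod_list (map norm vs)))"

section \<open>Banach manifolds and Banach-Lie groups\<close>

type_synonym ('m, 'a) charts = "('m set \<times> ('m \<Rightarrow> 'a)) set"

text \<open>A chart \<open>(U, \<phi>)\<close> is a total function \<open>\<phi>\<close> of which only the values on \<open>U\<close> matter.\<close>

definition banach_atlas :: "('m::topological_space, 'a::banach) charts \<Rightarrow> bool" where
  "banach_atlas A \<longleftrightarrow>
     (\<Union>(U, \<phi>)\<in>A. U) = UNIV \<and>
     (\<forall>(U, \<phi>)\<in>A. open U \<and> open (\<phi> ` U) \<and> homeomorphism U (\<phi> ` U) \<phi> (inv_into U \<phi>)) \<and>
     (\<forall>(U, \<phi>)\<in>A. \<forall>(V, \<psi>)\<in>A. smooth_on (\<phi> ` (U \<inter> V)) (\<psi> \<circ> inv_into U \<phi>))"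

definition vector_charts :: "('a, 'a) charts" where
  "vector_charts = {(UNIV, id)}"

definition prod_charts :: "('m, 'a) charts \<Rightarrow> ('n, 'b) charts \<Rightarrow> ('m \<times> 'n, 'a \<times> 'b) charts" where
  "prod_charts A B = {(U \<times> V, map_prod \<phi> \<psi>) | U \<phi> V \<psi>. (U, \<phi>) \<in> A \<and> (V, \<psi>) \<in> B}"

definition smooth_map_on ::
  "('m::topological_space, 'a::banach) charts \<Rightarrow> ('n::topological_space, 'b::banach) charts \<Rightarrow>
   'm set \<Rightarrow> ('m \<Rightarrow> 'n) \<Rightarrow> bool" where
  "smooth_map_on A B S f \<longleftrightarrow>
     open S \<and> continuous_on S f \<and>
     (\<forall>(U, \<phi>)\<in>A. \<forall>(V, \<psi>)\<in>B.
        smooth_on (\<phi> ` (S \<inter> U \<inter> f -` V)) (\<psi> \<circ> f \<circ> inv_into U \<phi>))"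

text \<open>
  The group is the whole type \<open>'g\<close>. The model space \<open>'a\<close> is the Lie algebra itself: \<open>(E, \<theta>)\<close> is a
  chart at the identity, its differential identifies the tangent space at \<open>e\<close> with \<open>'a\<close>, and the norm
  of \<open>'a\<close> is the norm of the Lie algebra. This is no loss of generality. All charts of a Lie group can be
  modelled on the tangent space at \<open>e\<close> by translation, and any complete norm on that space that
  defines its topology may be chosen as the norm of \<open>'a\<close>.
\<close>

locale banach_lie_group =
  group mul e invs
  for mul :: "'g::t2_space \<Rightarrow> 'g \<Rightarrow> 'g" and e :: 'g and invs :: "'g \<Rightarrow> 'g" +
  fixes A :: "('g, 'a::banach) charts"
    and E :: "'g set" and \<theta> :: "'g \<Rightarrow> 'a"
  assumes atlas: "banach_atlas A"
    and chart_at_identity: "(E, \<theta>) \<in> A" "e \<in> E"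
    and smooth_mult: "smooth_map_on (prod_charts A A) A UNIV (\<lambda>(g, h). mul g h)"
    and smooth_invs: "smooth_map_on A A UNIV invs"

text \<open>
  The exponential map is characterised by the property that \<open>t \<mapsto> expG (t v)\<close> is the smooth
  one-parameter subgroup with velocity \<open>v\<close> at \<open>e\<close>, for every \<open>v\<close>. The sets \<open>Ug\<close> and \<open>UG\<close> are the fixed
  neighbourhoods between which it is a diffeomorphism; \<open>UG\<close> is the domain of the logarithm.
\<close>

locale banach_lie_group_exp =
  banach_lie_group mul e invs A E \<theta>
  for mul :: "'g::t2_space \<Rightarrow> 'g \<Rightarrow> 'g" and e invs
    and A :: "('g, 'a::banach) charts" and E \<theta> +
  fixes expG :: "'a \<Rightarrow> 'g" and Ug :: "'a set" and UG :: "'g set"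
  assumes exp_add: "expG ((s + t) *\<^sub>R v) = mul (expG (s *\<^sub>R v)) (expG (t *\<^sub>R v))"
    and exp_smooth_curve: "smooth_map_on vector_charts A UNIV (\<lambda>t::real. expG (t *\<^sub>R v))"
    and exp_velocity: "((\<lambda>t. \<theta> (expG (t *\<^sub>R v))) has_vector_derivative v) (at 0)"
    and open_Ug: "open Ug" "0 \<in> Ug"
    and open_UG: "open UG" "e \<in> UG"
    and exp_bij: "bij_betw expG Ug UG"
    and exp_smooth: "smooth_map_on vector_charts A Ug expG"
    and log_smooth: "smooth_map_on A vector_charts UG (inv_into Ug expG)"

definition set_pow :: "('g \<Rightarrow> 'g \<Rightarrow> 'g) \<Rightarrow> 'g \<Rightarrow> 'g set \<Rightarrow> nat \<Rightarrow> 'g set" where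
  "set_pow mul e V m = {foldr mul gs e | gs. length gs = m \<and> set gs \<subseteq> V}"

text \<open>For an element outside every power of \<open>V\<close> this is \<open>\<infinity>\<close>.\<close>

definition power_index :: "('g \<Rightarrow> 'g \<Rightarrow> 'g) \<Rightarrow> 'g \<Rightarrow> 'g set \<Rightarrow> 'g \<Rightarrow> ereal" where
  "power_index mul e V g = (INF m\<in>{m. g \<in> set_pow mul e V m}. ereal (real m))"

section \<open>Multiplicative processes\<close>

definition additive_filtration :: "'w measure \<Rightarrow> (real \<Rightarrow> real \<Rightarrow> 'w measure) \<Rightarrow> bool" where
  "additive_filtration M F \<longleftrightarrow>
     (\<forall>s t. 0 \<le> s \<and> s \<le> t \<longrightarrow> subalgebra M (F s t)) \<and>
     (\<forall>s t u v. 0 \<le> s \<and> s \<le> t \<and> t \<le> u \<and> u \<le> v \<longrightarrow>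
        prob_space.indep_set M (sets (F s t)) (sets (F u v)) \<and>
        sets (F t u) \<subseteq> sets (F s v))"

text \<open>
  Completeness is required of the restriction of the probability measure to each sigma-algebra. This
  holds in particular if each of them contains all null sets of a complete \<open>M\<close>.
\<close>

definition usual_hypotheses :: "'w measure \<Rightarrow> (real \<Rightarrow> real \<Rightarrow> 'w measure) \<Rightarrow> bool" where
  "usual_hypotheses M F \<longleftrightarrow>
     (\<forall>s t. 0 \<le> s \<and> s \<le> t \<longrightarrow>
        sets (F s t) = (\<Inter>u\<in>{t<..}. sets (F s u)) \<and>
        complete_measure (restr_to_subalg M (F s t)))"

definition multiplicative_process ::
  "('g::topological_space \<Rightarrow> 'g \<Rightarrow> 'g) \<Rightarrow> 'g \<Rightarrow> ('g \<Rightarrow> 'g) \<Rightarrow>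
   'w measure \<Rightarrow> (real \<Rightarrow> real \<Rightarrow> 'w measure) \<Rightarrow> (real \<Rightarrow> real \<Rightarrow> 'w \<Rightarrow> 'g) \<Rightarrow> bool" where
  "multiplicative_process mul e invs M F x \<longleftrightarrow>
     (\<forall>s t. 0 \<le> s \<and> s \<le> t \<longrightarrow> x s t \<in> F s t \<rightarrow>\<^sub>M borel) \<and>
     (\<forall>s\<ge>0. AE \<omega> in M. x s s \<omega> = e) \<and>
     (\<forall>s t u. 0 \<le> s \<and> s \<le> t \<and> t \<le> u \<longrightarrow>
        (AE \<omega> in M. mul (x s t \<omega>) (x t u \<omega>) = x s u \<omega>)) \<and>
     (\<forall>s t U. 0 \<le> s \<and> s \<le> t \<and> open U \<and> e \<in> U \<longrightarrow>
        ((\<lambda>(h, k). measure M {\<omega>\<in>space M. mul (invs (x s t \<omega>)) (x (s + h) (t + k) \<omega>) \<in> U}) \<longlongrightarrow> 1)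
          (at (0, 0) within {(h, k). 0 \<le> s + h \<and> s + h \<le> t + k}))"

text \<open>
  Limits along the quadrants at \<open>(s, t)\<close>: approach from the left is strict, approach from the right
  is not. A limit along a quadrant that contains no nearby points of the domain exists trivially.
\<close>

definition cadlag_path :: "(real \<Rightarrow> real \<Rightarrow> 'g::topological_space) \<Rightarrow> bool" where
  "cadlag_path f \<longleftrightarrow>
     (\<forall>s t. 0 \<le> s \<and> s \<le> t \<longrightarrow>
        ((\<lambda>(s', t'). f s' t') \<longlongrightarrow> f s t) (at (s, t) within {(s', t'). s \<le> s' \<and> t \<le> t' \<and> s' \<le> t'}) \<and>
        (\<forall>I\<in>{{..<s}, {s..}}. \<forall>J\<in>{{..<t}, {t..}}. \<exists>l.
           ((\<lambda>(s', t'). f s' t') \<longlongrightarrow> l)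
             (at (s, t) within {(s', t'). s' \<in> I \<and> t' \<in> J \<and> 0 \<le> s' \<and> s' \<le> t'})))"

definition jump :: "'g::t2_space \<Rightarrow> (real \<Rightarrow> real \<Rightarrow> 'g) \<Rightarrow> real \<Rightarrow> 'g" where
  "jump e f t = (if t = 0 then e else Lim (at_left t) (\<lambda>s. f s t))"

definition bounded_jumps ::
  "('g::t2_space \<Rightarrow> 'g \<Rightarrow> 'g) \<Rightarrow> 'g \<Rightarrow> ('a::banach \<Rightarrow> 'g) \<Rightarrow> 'g set \<Rightarrow>
   'w measure \<Rightarrow> (real \<Rightarrow> real \<Rightarrow> 'w \<Rightarrow> 'g) \<Rightarrow> bool" where
  "bounded_jumps mul e expG UG M x \<longleftrightarrow>
     (\<exists>\<delta>>0. \<exists>n. expG ` ball 0 \<delta> \<subseteq> UG \<and>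
        (AE \<omega> in M. \<forall>t\<ge>0. jump e (\<lambda>s t. x s t \<omega>) t \<in> set_pow mul e (expG ` ball 0 \<delta>) n))"

section \<open>Expectation\<close>

definition exp_ereal :: "ereal \<Rightarrow> ennreal" where
  "exp_ereal a = (if a = \<infinity> then \<infinity> else if a = -\<infinity> then 0 else ennreal (exp (real_of_ereal a)))"

text \<open>
  The expectation below is that of a supremum over an uncountable set, whose measurability is not
  immediate (it rests on completeness and measurable projection). On a non-measurable function
  \<open>nn_integral\<close> is a lower integral, and its finiteness would say too little. The upper integral used
  here agrees with \<open>nn_integral\<close> on measurable functions.
\<close>

definition upper_expectation :: "'w measure \<Rightarrow> ('w \<Rightarrow> ennreal) \<Rightarrow> ennreal" where
  "upper_expectation M f =
     (INF g\<in>{g \<in> borel_measurable M. \<forall>\<omega>\<in>space M. f \<omega> \<le> g \<omega>}. \<integral>\<^sup>+\<omega>. g \<omega> \<partial>M)"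

lemma nn_integral_le_upper_expectation: "(\<integral>\<^sup>+\<omega>. f \<omega> \<partial>M) \<le> upper_expectation M f"
  unfolding upper_expectation_def by (intro INF_greatest nn_integral_mono) auto

lemma upper_expectation_measurable:
  assumes "f \<in> borel_measurable M"
  shows "upper_expectation M f = (\<integral>\<^sup>+\<omega>. f \<omega> \<partial>M)"
  using assms unfolding upper_expectation_def
  by (intro antisym INF_lower INF_greatest nn_integral_mono) auto

end

(* Fix a neighbourhood K of e inside V and count the disjoint time intervals over which the increment
   of x leaves K. By stochastic continuity such an interval of length at most eta has small
   probability (Ottaviani), so by independence of increments the number of them in [r, u] has a
   geometric tail, with ratio as small as desired. A path with at most k such intervals is a product of
   boundedly many elements of V per interval, because between the jumps it moves inside K and
   the jumps lie in a fixed power of V. *)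

theory Submission
  imports Defs
begin

section \<open>Topological groups\<close>

text \<open>Exit times and suprema over uncountably many times raise measurability questions. The
  counting is therefore done by the mere existence of a \<open>chain\<close> of intervals with end
  points in a set of times. For a finite set the earliest completed interval splits the event into
  disjoint pieces, and the bounds do not depend on the set, so they extend to the rationals. That
  \<open>K\<close> is closed serves twice: leaving \<open>K\<close> is an open condition, which
  right-continuity carries from real to rational times, and the left limit at an exit time still
  lies in \<open>K\<close>. The ratio \<open>2 * \<rho>\<close> of the tail can be made small at the
  price of a factor \<open>(1 / \<rho>) ^ m\<close>, where \<open>m\<close> windows of length
  \<open>\<eta>\<close> cover the time interval; this factor does not depend on the number of
  intervals counted. The power of \<open>V\<close> that contains the jumps arises by dividing
  one-parameter subgroups into short steps.\<close>

locale topological_group_on = group mul e invs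
  for mul :: "'g::t2_space \<Rightarrow> 'g \<Rightarrow> 'g" and e :: 'g and invs :: "'g \<Rightarrow> 'g" +
  assumes continuous_mul: "continuous_on UNIV (\<lambda>(g, h). mul g h)"
    and continuous_invs: "continuous_on UNIV invs"
begin

lemma tendsto_mul:
  assumes "(f \<longlongrightarrow> a) F" and "(g \<longlongrightarrow> b) F"
  shows "((\<lambda>y. mul (f y) (g y)) \<longlongrightarrow> mul a b) F"
proof -
  have "isCont (\<lambda>(g, h). mul g h) (a, b)"
    using continuous_mul by (simp add: continuous_on_eq_continuous_at)
  from isCont_tendsto_compose[OF this tendsto_Pair[OF assms]] show ?thesis by simp
qed

lemma tendsto_invs:
  assumes "(f \<longlongrightarrow> a) F"
  shows "((\<lambda>y. invs (f y)) \<longlongrightarrow> invs a) F"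
proof -
  have "isCont invs a"
    using continuous_invs by (simp add: continuous_on_eq_continuous_at)
  from isCont_tendsto_compose[OF this assms] show ?thesis .
qed

lemma invs_mul_cancel [simp]: "mul (invs a) (mul a b) = b" "mul a (mul (invs a) b) = b"
  by (simp_all flip: assoc)

section \<open>Neighbourhoods of the identity\<close>

lemma ex_symmetric_nbhd:
  assumes "open V" and "e \<in> V"
  obtains W where "open W" "e \<in> W" "\<And>g. g \<in> W \<Longrightarrow> invs g \<in> W"
    "\<And>g h. g \<in> W \<Longrightarrow> h \<in> W \<Longrightarrow> mul g h \<in> V"
proof -
  have "open ((\<lambda>(g, h). mul g h) -` V)"
    using continuous_mul assms(1) by (simp add: open_vimage)
  moreover have "(e, e) \<in> (\<lambda>(g, h). mul g h) -` V"
    using assms(2) by simp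
  ultimately obtain A B where AB: "open A" "open B" "e \<in> A" "e \<in> B"
    "A \<times> B \<subseteq> (\<lambda>(g, h). mul g h) -` V"
    by (auto elim!: open_prod_elim)
  define W where "W = (A \<inter> B) \<inter> invs -` (A \<inter> B)"
  show thesis
  proof
    show "open W"
      unfolding W_def using AB continuous_invs by (intro open_Int open_vimage) auto
    show "e \<in> W"
      using AB by (simp add: W_def)
    show "invs g \<in> W" if "g \<in> W" for g
      using that by (simp add: W_def)
    show "mul g h \<in> V" if "g \<in> W" "h \<in> W" for g h
      using that AB(5) by (auto simp: W_def)
  qed
qed

text \<open>Topological groups are regular: a point \<open>g\<close> adherent to \<open>W\<close>
  has the neighbourhood \<open>g W\<close>, which meets \<open>W\<close>, so \<open>g\<close> is a
  quotient of two elements of \<open>W\<close>. This supplies the closed set \<open>K\<close> inside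
  \<open>V\<close>.\<close>

lemma ex_closed_nbhd:
  assumes "open V" and "e \<in> V"
  obtains W where "open W" "e \<in> W" "closure W \<subseteq> V"
proof -
  obtain W where W: "open W" "e \<in> W" "\<And>g. g \<in> W \<Longrightarrow> invs g \<in> W"
    "\<And>g h. g \<in> W \<Longrightarrow> h \<in> W \<Longrightarrow> mul g h \<in> V"
    using ex_symmetric_nbhd[OF assms] by blast
  have "g \<in> V" if g: "g \<in> closure W" for g
  proof -
    have "((\<lambda>h. mul (invs g) h) \<longlongrightarrow> mul (invs g) a) (at a)" for a
      by (intro tendsto_mul tendsto_const tendsto_ident_at)
    then have "continuous_on UNIV (\<lambda>h. mul (invs g) h)"
      by (simp add: continuous_on_def)
    then have "open ((\<lambda>h. mul (invs g) h) -` W)"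
      using W(1) by (simp add: open_vimage)
    moreover have "g \<in> (\<lambda>h. mul (invs g) h) -` W"
      using W(2) by simp
    ultimately obtain h where h: "h \<in> W" "mul (invs g) h \<in> W"
      using g by (metis closure_iff_nhds_not_empty disjoint_iff vimageE subset_refl)
    have "g = mul h (invs (mul (invs g) h))"
      by (simp add: inverse_distrib_swap flip: assoc)
    then show "g \<in> V"
      using W(3,4) h by metis
  qed
  then show thesis using that W by blast
qed

section \<open>Powers of a neighbourhood\<close>

lemma foldr_mul_append: "foldr mul (gs @ hs) e = mul (foldr mul gs e) (foldr mul hs e)"
  by (induction gs) (simp_all add: assoc)

lemma set_pow_0: "e \<in> set_pow mul e V 0"
  by (simp add: set_pow_def)

lemma set_pow_1: "g \<in> V \<Longrightarrow> g \<in> set_pow mul e V 1"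
  unfolding set_pow_def by (rule CollectI, rule exI[of _ "[g]"]) simp

lemma set_pow_add:
  assumes "g \<in> set_pow mul e V m" and "h \<in> set_pow mul e V n"
  shows "mul g h \<in> set_pow mul e V (m + n)"
proof -
  obtain gs hs where "g = foldr mul gs e" "h = foldr mul hs e" "length gs = m" "length hs = n"
    "set gs \<subseteq> V" "set hs \<subseteq> V"
    using assms by (auto simp: set_pow_def)
  then show ?thesis
    unfolding set_pow_def by (intro CollectI exI[of _ "gs @ hs"]) (simp add: foldr_mul_append del: foldr_append)
qed

lemma set_pow_mono:
  assumes "g \<in> set_pow mul e V m" and "m \<le> n" and "e \<in> V"
  shows "g \<in> set_pow mul e V n"
  using assms(2)
proof (induction n rule: dec_induct)
  case base
  show ?case by (rule assms(1))
next
  case (step n)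
  have "mul g e \<in> set_pow mul e V (n + 1)"
    by (intro set_pow_add step.IH set_pow_1 assms(3))
  then show ?case by simp
qed

text \<open>Carries the bound on the jumps from powers of an exponential ball to powers of the
  arbitrary \<open>V\<close>.\<close>

lemma set_pow_set_pow:
  assumes "g \<in> set_pow mul e U n" and "U \<subseteq> set_pow mul e V k"
  shows "g \<in> set_pow mul e V (k * n)"
proof -
  obtain gs where gs: "g = foldr mul gs e" "length gs = n" "set gs \<subseteq> U"
    using assms(1) by (auto simp: set_pow_def)
  have "set gs \<subseteq> U \<Longrightarrow> foldr mul gs e \<in> set_pow mul e V (k * length gs)" for gs
  proof (induction gs)
    case Nil
    then show ?case by (simp add: set_pow_0)
  next
    case (Cons g gs)
    then have "mul g (foldr mul gs e) \<in> set_pow mul e V (k + k * length gs)"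
      using assms(2) by (intro set_pow_add) auto
    then show ?case by simp
  qed
  with gs show ?thesis by blast
qed

end

sublocale banach_lie_group \<subseteq> topological_group_on mul e invs
proof
  show "continuous_on UNIV (\<lambda>(g, h). mul g h)" "continuous_on UNIV invs"
    using smooth_mult smooth_invs by (auto simp: smooth_map_on_def)
qed

text \<open>The element \<open>expG v\<close> is the \<open>k\<close>-th power of
  \<open>expG ((1 / real k) *\<^sub>R v)\<close>, and a single \<open>k\<close> shrinks the whole
  ball into the preimage of \<open>V\<close>. Boundedness in norm is enough, although the ball need
  not be compact.\<close>

lemma (in banach_lie_group_exp) exp_ball_subset_set_pow:
  assumes "open V" and "e \<in> V"
  obtains k where "expG ` ball 0 \<delta> \<subseteq> set_pow mul e V k"
proof -
  have "expG ((0 + 0) *\<^sub>R 0) = mul (expG (0 *\<^sub>R 0)) (expG (0 *\<^sub>R 0))"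
    by (rule exp_add)
  then have "mul (expG 0) (expG 0) = mul (expG 0) e"
    by simp
  then have exp0: "expG 0 = e"
    by (simp only: left_cancel)
  have "open (expG -` V \<inter> Ug)"
    using exp_smooth assms(1) continuous_on_open_vimage[OF open_Ug(1)]
    by (auto simp: smooth_map_on_def)
  then obtain d where d: "d > 0" "ball 0 d \<subseteq> expG -` V \<inter> Ug"
    using open_Ug(2) assms(2) exp0 open_contains_ball by (metis IntI vimageI)
  obtain k :: nat where k: "\<bar>\<delta>\<bar> / d < real k" "k > 0"
    using reals_Archimedean2 by (metis abs_ge_zero d(1) divide_nonneg_pos gr0I le_less_trans
        not_less of_nat_0)
  have "expG v \<in> set_pow mul e V k" if "v \<in> ball 0 \<delta>" for v
  proof -
    have "norm v < real k * d"
      using k that d(1) by (simp add: field_simps)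
    then have "norm ((1 / real k) *\<^sub>R v) < d"
      using k(2) by (simp add: field_simps)
    then have V: "expG ((1 / real k) *\<^sub>R v) \<in> V"
      using d(2) by (auto simp: subset_iff)
    have "expG ((real i / real k) *\<^sub>R v) \<in> set_pow mul e V i" for i
    proof (induction i)
      case 0
      then show ?case by (simp add: exp0 set_pow_0)
    next
      case (Suc i)
      have "expG ((real (Suc i) / real k) *\<^sub>R v) = expG ((real i / real k + 1 / real k) *\<^sub>R v)"
        by (simp add: add_divide_distrib add.commute)
      also have "\<dots> \<in> set_pow mul e V (i + 1)"
        unfolding exp_add by (intro set_pow_add Suc.IH set_pow_1 V)
      finally show ?case by simp
    qed
    from this[of k] show ?thesis
      using k(2) by simp
  qed
  then show thesis
    by (intro that) blast
qed

section \<open>Chains of disjoint intervals\<close>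

text \<open>The argument \<open>lo\<close> is the end of the preceding interval, so that removing an
  interval leaves a chain of the same form. The set \<open>T\<close> of admissible times varies:
  finite sets have earliest completions, countable ones give events, and real intervals describe the
  path.\<close>

primrec chain :: "(real \<Rightarrow> real \<Rightarrow> bool) \<Rightarrow> real set \<Rightarrow> nat \<Rightarrow> real \<Rightarrow> bool" where
  "chain B T 0 lo \<longleftrightarrow> True"
| "chain B T (Suc k) lo \<longleftrightarrow> (\<exists>i\<in>T. \<exists>j\<in>T. lo \<le> i \<and> i < j \<and> B i j \<and> chain B T k j)"

lemma chain_antimono: "chain B T k lo \<Longrightarrow> lo' \<le> lo \<Longrightarrow> chain B T k lo'"
  by (cases k) (auto intro: order_trans)

lemma chain_mono: "chain B T k lo \<Longrightarrow> T \<subseteq> T' \<Longrightarrow> chain B T' k lo"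
  by (induction k arbitrary: lo) (simp, simp, blast)

lemma chain_finite_subset:
  "chain B T k lo \<Longrightarrow> \<exists>T'. finite T' \<and> T' \<subseteq> T \<and> chain B T' k lo"
proof (induction k arbitrary: lo)
  case 0
  then show ?case by auto
next
  case (Suc k)
  then obtain i j where ij: "i \<in> T" "j \<in> T" "lo \<le> i" "i < j" "B i j" "chain B T k j"
    by auto
  then obtain T' where T': "finite T'" "T' \<subseteq> T" "chain B T' k j"
    using Suc.IH by blast
  have "chain B (insert i (insert j T')) k j"
    by (rule chain_mono[OF T'(3)]) auto
  then show ?case
    using ij T' by (intro exI[of _ "insert i (insert j T')"]) auto
qed

section \<open>Cadlag paths\<close>

lemma cadlag_path_right_nbhd:
  assumes "cadlag_path f" and "0 \<le> s" "s \<le> t" and "open U" "f s t \<in> U"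
  obtains d where "d > 0"
    "\<And>s' t'. s \<le> s' \<Longrightarrow> t \<le> t' \<Longrightarrow> s' \<le> t' \<Longrightarrow> s' < s + d \<Longrightarrow> t' < t + d \<Longrightarrow> f s' t' \<in> U"
proof -
  let ?S = "{(s', t'). s \<le> s' \<and> t \<le> t' \<and> s' \<le> t'}"
  have "((\<lambda>(s', t'). f s' t') \<longlongrightarrow> f s t) (at (s, t) within ?S)"
    using assms(1-3) by (simp add: cadlag_path_def)
  then have "\<forall>\<^sub>F y in at (s, t) within ?S. (\<lambda>(s', t'). f s' t') y \<in> U"
    using assms(4,5) by (rule topological_tendstoD)
  then obtain d where d: "d > 0"
    "\<And>y. y \<in> ?S \<Longrightarrow> y \<noteq> (s, t) \<Longrightarrow> dist y (s, t) < d \<Longrightarrow> (\<lambda>(s', t'). f s' t') y \<in> U"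
    unfolding eventually_at by blast
  show thesis
  proof
    show "d / 2 > 0"
      using d(1) by simp
    fix s' t' assume *: "s \<le> s'" "t \<le> t'" "s' \<le> t'" "s' < s + d / 2" "t' < t + d / 2"
    have "dist (s', t') (s, t) \<le> \<bar>s' - s\<bar> + \<bar>t' - t\<bar>"
      by (simp add: dist_Pair_Pair dist_real_def sqrt_sum_squares_le_sum_abs)
    then have "dist (s', t') (s, t) < d"
      using * by linarith
    then show "f s' t' \<in> U"
      using * d(2)[of "(s', t')"] assms(5) by (cases "(s', t') = (s, t)") auto
  qed
qed

text \<open>By right-continuity both end points of an interval can slip to the right while the
  increment stays in the open set; the half-open range leaves room below \<open>b\<close>. The
  strict \<open>lo' > lo\<close> is what the induction needs: it leaves room for the moved end point
  before the moved remainder of the chain.\<close>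

lemma chain_open_rational:
  assumes "cadlag_path f" and "open O'" and "0 \<le> a"
  shows "chain (\<lambda>s t. f s t \<in> O') {a..<b} k lo \<Longrightarrow>
    \<exists>lo'>lo. chain (\<lambda>s t. f s t \<in> O') ({a..<b} \<inter> \<rat>) k lo'"
proof (induction k arbitrary: lo)
  case 0
  then show ?case using lt_ex gt_ex by auto
next
  case (Suc k)
  then obtain i j where ij: "i \<in> {a..<b}" "j \<in> {a..<b}" "lo \<le> i" "i < j" "f i j \<in> O'"
    "chain (\<lambda>s t. f s t \<in> O') {a..<b} k j"
    by auto
  then obtain j2 where j2: "j2 > j" "chain (\<lambda>s t. f s t \<in> O') ({a..<b} \<inter> \<rat>) k j2"
    using Suc.IH by blast
  obtain d where d: "d > 0" "\<And>s' t'. i \<le> s' \<Longrightarrow> j \<le> t' \<Longrightarrow> s' \<le> t' \<Longrightarrow> s' < i + d \<Longrightarrow>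
      t' < j + d \<Longrightarrow> f s' t' \<in> O'"
    using cadlag_path_right_nbhd[OF assms(1) _ _ assms(2) ij(5)] ij assms(3) by auto
  obtain i' where i': "i' \<in> \<rat>" "i < i'" "i' < min j (i + d)"
    using Rats_dense_in_real[of i "min j (i + d)"] d ij by auto
  obtain j' where j': "j' \<in> \<rat>" "j < j'" "j' < min (min b j2) (j + d)"
    using Rats_dense_in_real[of j "min (min b j2) (j + d)"] d ij j2 by auto
  have "chain (\<lambda>s t. f s t \<in> O') ({a..<b} \<inter> \<rat>) k j'"
    using j2(2) by (rule chain_antimono) (use j' in auto)
  moreover have "f i' j' \<in> O'"
    using i' j' ij by (intro d(2)) auto
  ultimately have "chain (\<lambda>s t. f s t \<in> O') ({a..<b} \<inter> \<rat>) (Suc k) i'"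
    using i' j' ij unfolding chain.simps by (intro bexI[of _ i'] bexI[of _ j'] conjI) auto
  then show ?case
    using i' ij by (intro exI[of _ i']) auto
qed

section \<open>From chains to powers of a neighbourhood\<close>

context topological_group_on
begin

lemma multiplicative_diag:
  fixes f :: "real \<Rightarrow> real \<Rightarrow> 'g"
  assumes "\<And>s t u. 0 \<le> s \<Longrightarrow> s \<le> t \<Longrightarrow> t \<le> u \<Longrightarrow> mul (f s t) (f t u) = f s u" and "0 \<le> s"
  shows "f s s = e"
proof -
  have "mul (f s s) (f s s) = mul (f s s) e"
    using assms(1)[OF assms(2) order_refl order_refl] by simp
  then show ?thesis by (simp only: left_cancel)
qed

text \<open>A real number is approximated from the right by \<open>(\<lfloor>n s\<rfloor> + 1) / n\<close>, which is monotone in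
  \<open>s\<close>, so that the approximations of ordered times are ordered.\<close>

lemma multiplicative_if_rational:
  assumes cadlag: "cadlag_path f"
    and rat: "\<And>s t u. s \<in> \<rat> \<Longrightarrow> t \<in> \<rat> \<Longrightarrow> u \<in> \<rat> \<Longrightarrow> 0 \<le> s \<Longrightarrow> s \<le> t \<Longrightarrow> t \<le> u \<Longrightarrow>
      mul (f s t) (f t u) = f s u"
    and "0 \<le> s" "s \<le> t" "t \<le> u"
  shows "mul (f s t) (f t u) = f s u"
proof -
  define q where "q n s = (of_int \<lfloor>real (Suc n) * s\<rfloor> + 1) / real (Suc n)" for n :: nat and s :: real
  have q_rat: "q n s \<in> \<rat>" for n s
    unfolding q_def by (intro Rats_divide Rats_add) auto
  have q_gt: "s < q n s" for n s
    unfolding q_def by (simp add: field_simps) linarith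
  have q_mono: "q n s \<le> q n t" if "s \<le> t" for n s t
  proof -
    have "\<lfloor>real (Suc n) * s\<rfloor> \<le> \<lfloor>real (Suc n) * t\<rfloor>"
      using that by (intro floor_mono mult_left_mono) auto
    then show ?thesis
      unfolding q_def by (intro divide_right_mono) auto
  qed
  have q_le: "q n s \<le> s + inverse (real (Suc n))" for n s
  proof -
    have "of_int \<lfloor>real (Suc n) * s\<rfloor> + 1 \<le> real (Suc n) * s + 1"
      by (simp only: add_le_cancel_right of_int_floor_le)
    then have "q n s \<le> (real (Suc n) * s + 1) / real (Suc n)"
      unfolding q_def by (intro divide_right_mono) auto
    then show ?thesis by (simp add: add_divide_distrib inverse_eq_divide)
  qed
  have lim: "(\<lambda>n. f (q n s) (q n t)) \<longlonglongrightarrow> f s t" if st: "0 \<le> s" "s \<le> t" for s t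
  proof (rule topological_tendstoI)
    fix U assume "open U" "f s t \<in> U"
    then obtain d where d: "d > 0" "\<And>s' t'. s \<le> s' \<Longrightarrow> t \<le> t' \<Longrightarrow> s' \<le> t' \<Longrightarrow> s' < s + d \<Longrightarrow>
        t' < t + d \<Longrightarrow> f s' t' \<in> U"
      using cadlag_path_right_nbhd[OF cadlag st] by blast
    have "\<forall>\<^sub>F n in sequentially. inverse (real (Suc n)) < d"
      using LIMSEQ_inverse_real_of_nat d(1) by (rule order_tendstoD)
    then show "\<forall>\<^sub>F n in sequentially. f (q n s) (q n t) \<in> U"
    proof eventually_elim
      case (elim n)
      show ?case
        using q_gt[of s n] q_gt[of t n] q_mono[OF st(2), of n] q_le[of n s] q_le[of n t] elim
        by (intro d(2)) auto
    qed
  qed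
  have "mul (f (q n s) (q n t)) (f (q n t) (q n u)) = f (q n s) (q n u)" for n
    using assms(3-5) q_gt[of s n] by (intro rat q_rat q_mono) auto
  then have "(\<lambda>n. f (q n s) (q n u)) \<longlonglongrightarrow> mul (f s t) (f t u)"
    using tendsto_mul[OF lim lim, of s t t u] assms(3-5) by auto
  moreover have "(\<lambda>n. f (q n s) (q n u)) \<longlonglongrightarrow> f s u"
    using lim assms(3-5) by auto
  ultimately show ?thesis
    by (rule LIMSEQ_unique)
qed

text \<open>Up to the first exit time \<open>\<tau>\<close> of \<open>f s\<close> from \<open>K\<close> the path stays in \<open>K\<close>, the jump at \<open>\<tau>\<close> costs
  \<open>p\<close> factors, and one more factor leads to a time after \<open>\<tau>\<close> at which an interval of the
  chain has been completed.\<close>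

lemma mem_set_pow_if_not_chain:
  assumes cadlag: "cadlag_path f"
    and mult: "\<And>s t u. 0 \<le> s \<Longrightarrow> s \<le> t \<Longrightarrow> t \<le> u \<Longrightarrow> mul (f s t) (f t u) = f s u"
    and jumps: "\<And>t. 0 \<le> t \<Longrightarrow> jump e f t \<in> set_pow mul e V p"
    and K: "closed K" "K \<subseteq> V" and V: "open V" "e \<in> V"
    and "0 \<le> a"
  shows "\<not> chain (\<lambda>s t. f s t \<notin> K) {a..<b} k s \<Longrightarrow> a \<le> s \<Longrightarrow> s \<le> t \<Longrightarrow> t < b \<Longrightarrow>
    f s t \<in> set_pow mul e V (k * (p + 2))"
proof (induction k arbitrary: s)
  case 0
  then show ?case by simp
next
  case (Suc k)
  have diag: "f s s = e" if "0 \<le> s" for s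
    using multiplicative_diag[of f, OF mult that] .
  define X where "X = {t'. s < t' \<and> t' \<le> t \<and> f s t' \<notin> K}"
  show ?case
  proof (cases "X = {}")
    case True
    have "f s t \<in> V"
    proof (cases "s = t")
      case True
      then show ?thesis using diag[of s] Suc.prems assms(8) V(2) by simp
    next
      case False
      then show ?thesis using True Suc.prems K(2) by (auto simp: X_def)
    qed
    then have "f s t \<in> set_pow mul e V 1"
      by (rule set_pow_1)
    then show ?thesis
      by (rule set_pow_mono) (use V in auto)
  next
    case False
    define \<tau> where "\<tau> = Inf X"
    have bdd: "bdd_below X"
      by (rule bdd_belowI[of _ s]) (auto simp: X_def)
    have \<tau>: "s \<le> \<tau>" "\<tau> \<le> t"
      unfolding \<tau>_def using False cInf_lower[OF _ bdd]
      by (auto intro!: cInf_greatest simp: X_def) (meson cInf_lower[OF _ bdd] order_trans)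
    have before: "f s t' \<in> K" if "s < t'" "t' < \<tau>" for t'
      using that \<tau>(2) cInf_lower[OF _ bdd, of t'] by (force simp: X_def \<tau>_def)
    have s0: "0 \<le> s"
      using Suc.prems assms(8) by simp
    \<comment> \<open>One factor in \<open>K\<close> before the jump and \<open>p\<close> factors
      for the jump. With the factor after \<open>\<tau>\<close> this makes \<open>p + 2\<close> per
      interval.\<close>
    have at_exit: "f s \<tau> \<in> set_pow mul e V (1 + p)"
    proof (cases "s = \<tau>")
      case True
      then have "f s \<tau> \<in> set_pow mul e V 1"
        using diag[OF s0] V(2) by (metis set_pow_1)
      then show ?thesis
        by (rule set_pow_mono) (use V in auto)
    next
      case False
      then have s\<tau>: "s < \<tau>" using \<tau> by simp
      have "\<forall>I\<in>{{..<\<tau>}, {\<tau>..}}. \<forall>J\<in>{{..<\<tau>}, {\<tau>..}}. \<exists>l. ((\<lambda>(s', t'). f s' t') \<longlongrightarrow> l)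
          (at (\<tau>, \<tau>) within {(s', t'). s' \<in> I \<and> t' \<in> J \<and> 0 \<le> s' \<and> s' \<le> t'})"
        using cadlag s0 s\<tau> by (simp add: cadlag_path_def)
      \<comment> \<open>This quadrant contains the points \<open>(s', \<tau>)\<close> with
        \<open>s' < \<tau>\<close>, so its limit is the jump at \<open>\<tau>\<close>.\<close>
      then obtain l where l: "((\<lambda>(s', t'). f s' t') \<longlongrightarrow> l)
          (at (\<tau>, \<tau>) within {(s', t'). s' \<in> {..<\<tau>} \<and> t' \<in> {\<tau>..} \<and> 0 \<le> s' \<and> s' \<le> t'})"
        by blast
      have ev: "\<forall>\<^sub>F s' in at_left \<tau>. s < s' \<and> s' < \<tau>"
        using s\<tau> by (auto simp: eventually_at_left_field)
      have "filterlim (\<lambda>s'. (s', \<tau>))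
          (at (\<tau>, \<tau>) within {(s', t'). s' \<in> {..<\<tau>} \<and> t' \<in> {\<tau>..} \<and> 0 \<le> s' \<and> s' \<le> t'}) (at_left \<tau>)"
        unfolding filterlim_at
      proof
        show "\<forall>\<^sub>F s' in at_left \<tau>. (s', \<tau>) \<in> {(s', t'). s' \<in> {..<\<tau>} \<and> t' \<in> {\<tau>..} \<and> 0 \<le> s' \<and> s' \<le> t'}
            \<and> (s', \<tau>) \<noteq> (\<tau>, \<tau>)"
          using ev by eventually_elim (use s0 in auto)
        show "((\<lambda>s'. (s', \<tau>)) \<longlongrightarrow> (\<tau>, \<tau>)) (at_left \<tau>)"
          by (intro tendsto_Pair tendsto_const tendsto_ident_at)
      qed
      from filterlim_compose[OF l this]
      have l': "((\<lambda>s'. f s' \<tau>) \<longlongrightarrow> l) (at_left \<tau>)" by simp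
      have "jump e f \<tau> = l"
        using tendsto_Lim[OF _ l'] s\<tau> s0 by (simp add: jump_def)
      then have lp: "l \<in> set_pow mul e V p"
        using jumps[of \<tau>] s0 s\<tau> by simp
      \<comment> \<open>For \<open>s < s' < \<tau>\<close> this quotient equals
        \<open>f s s'\<close>, which lies in \<open>K\<close>. The limit therefore splits
        \<open>f s \<tau>\<close> into an element of the closed set \<open>K\<close> and the jump
        \<open>l\<close>.\<close>
      have "((\<lambda>s'. mul (f s \<tau>) (invs (f s' \<tau>))) \<longlongrightarrow> mul (f s \<tau>) (invs l)) (at_left \<tau>)"
        by (intro tendsto_mul tendsto_invs l' tendsto_const)
      moreover have "\<forall>\<^sub>F s' in at_left \<tau>. mul (f s \<tau>) (invs (f s' \<tau>)) \<in> K"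
        using ev
      proof eventually_elim
        case (elim s')
        then have "f s \<tau> = mul (f s s') (f s' \<tau>)"
          using mult s0 by simp
        then have "mul (f s \<tau>) (invs (f s' \<tau>)) = f s s'"
          by (simp add: assoc)
        then show ?case using before elim by simp
      qed
      ultimately have "mul (f s \<tau>) (invs l) \<in> K"
        using K(1) by (intro Lim_in_closed_set) auto
      then have "mul (mul (f s \<tau>) (invs l)) l \<in> set_pow mul e V (1 + p)"
        using K(2) by (intro set_pow_add lp set_pow_1) auto
      then show ?thesis by (simp add: assoc)
    qed
    have "f \<tau> \<tau> \<in> V"
      using diag[of \<tau>] s0 \<tau> V(2) by simp
    then obtain d where d: "d > 0" "\<And>s' t'. \<tau> \<le> s' \<Longrightarrow> \<tau> \<le> t' \<Longrightarrow> s' \<le> t' \<Longrightarrow> s' < \<tau> + d \<Longrightarrow>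
        t' < \<tau> + d \<Longrightarrow> f s' t' \<in> V"
      using cadlag_path_right_nbhd[OF cadlag _ _ V(1), of \<tau> \<tau>] s0 \<tau> by auto
    \<comment> \<open>The infimum \<open>\<tau>\<close> need not belong to \<open>X\<close>. A
      nearby \<open>t'\<close> in \<open>X\<close> is a genuine exit time, and the increment from
      \<open>\<tau>\<close> to \<open>t'\<close> still lies in \<open>V\<close>.\<close>
    obtain t' where t': "t' \<in> X" "t' < \<tau> + d"
      using cInf_lessD[OF False, of "\<tau> + d"] d(1) by (auto simp: \<tau>_def)
    have \<tau>t': "\<tau> \<le> t'"
      unfolding \<tau>_def using t'(1) bdd by (rule cInf_lower)
    \<comment> \<open>The increment from \<open>s\<close> to \<open>t'\<close> lies outside
      \<open>K\<close>, so this interval would extend a chain of length \<open>k\<close> after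
      \<open>t'\<close> to one of length \<open>Suc k\<close> after \<open>s\<close>.\<close>
    have "\<not> chain (\<lambda>s t. f s t \<notin> K) {a..<b} k t'"
      using Suc.prems t'(1) by (force simp: X_def)
    then have "f t' t \<in> set_pow mul e V (k * (p + 2))"
      using Suc.prems t'(1) by (intro Suc.IH) (auto simp: X_def)
    moreover have "f \<tau> t' \<in> set_pow mul e V 1"
      using t' \<tau>t' d by (intro set_pow_1 d(2)) auto
    ultimately have "mul (f s \<tau>) (mul (f \<tau> t') (f t' t)) \<in> set_pow mul e V ((1 + p) + (1 + k * (p + 2)))"
      by (intro set_pow_add at_exit)
    also have "mul (f s \<tau>) (mul (f \<tau> t') (f t' t)) = f s t"
      using mult s0 \<tau> \<tau>t' t'(1) by (simp add: X_def)
    finally show ?thesis by (simp add: algebra_simps)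
  qed
qed

end

section \<open>First entrance decomposition\<close>

text \<open>Only events of earlier indices are removed. Hence, for adapted \<open>E\<close>, the
  piece at \<open>j\<close> is determined by time \<open>j\<close> and is independent of later
  increments.\<close>

definition first_at :: "real set \<Rightarrow> (real \<Rightarrow> 'w set) \<Rightarrow> real \<Rightarrow> 'w set" where
  "first_at S E j = E j - (\<Union>i\<in>{i \<in> S. i < j}. E i)"

text \<open>Finiteness provides a least index; in a dense set of times there may be none, which is
  why the estimates start from finite sets of times.\<close>

lemma UN_first_at:
  assumes "finite S"
  shows "(\<Union>j\<in>S. first_at S E j) = (\<Union>j\<in>S. E j)"
proof
  show "(\<Union>j\<in>S. first_at S E j) \<subseteq> (\<Union>j\<in>S. E j)"
    by (auto simp: first_at_def)
  show "(\<Union>j\<in>S. E j) \<subseteq> (\<Union>j\<in>S. first_at S E j)"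
  proof
    fix \<omega> assume "\<omega> \<in> (\<Union>j\<in>S. E j)"
    then have ne: "{j \<in> S. \<omega> \<in> E j} \<noteq> {}" by auto
    have fin: "finite {j \<in> S. \<omega> \<in> E j}" using assms by simp
    from Min_in[OF fin ne] Min_le[OF fin]
    have "\<omega> \<in> first_at S E (Min {j \<in> S. \<omega> \<in> E j})" "Min {j \<in> S. \<omega> \<in> E j} \<in> S"
      by (auto simp: first_at_def not_less[symmetric])
    then show "\<omega> \<in> (\<Union>j\<in>S. first_at S E j)" by blast
  qed
qed

lemma disjoint_family_first_at: "disjoint_family_on (first_at S E) S"
  unfolding disjoint_family_on_def first_at_def
proof (intro ballI impI)
  fix i j assume "i \<in> S" "j \<in> S" "i \<noteq> j"
  then show "(E i - (\<Union>l\<in>{l \<in> S. l < i}. E l)) \<inter> (E j - (\<Union>l\<in>{l \<in> S. l < j}. E l)) = {}"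
    by (cases "i < j") auto
qed

context prob_space
begin

lemma prob_UN_first_at:
  assumes "finite S" and "\<And>j. j \<in> S \<Longrightarrow> E j \<in> events"
  shows "prob (\<Union>j\<in>S. E j) = (\<Sum>j\<in>S. prob (first_at S E j))"
proof -
  have "first_at S E j \<in> events" if "j \<in> S" for j
    unfolding first_at_def using assms that by (intro sets.Diff sets.finite_UN) auto
  then have "prob (\<Union>j\<in>S. first_at S E j) = (\<Sum>j\<in>S. prob (first_at S E j))"
    by (intro finite_measure_finite_Union assms(1) disjoint_family_first_at) auto
  then show ?thesis
    by (simp only: UN_first_at[OF assms(1)])
qed

text \<open>A discrete substitute for the strong Markov property: the pieces are disjoint, so
  independence is only required between \<open>first_at S E j\<close> and \<open>G j\<close> for the
  same \<open>j\<close>.\<close>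

lemma prob_UN_first_at_Int:
  assumes "finite S" and "\<And>j. j \<in> S \<Longrightarrow> E j \<in> events" and "\<And>j. j \<in> S \<Longrightarrow> G j \<in> events"
    and "\<And>j. j \<in> S \<Longrightarrow> prob (first_at S E j \<inter> G j) = prob (first_at S E j) * prob (G j)"
  shows "prob (\<Union>j\<in>S. first_at S E j \<inter> G j) = (\<Sum>j\<in>S. prob (first_at S E j) * prob (G j))"
proof -
  have "first_at S E j \<in> events" if "j \<in> S" for j
    unfolding first_at_def using assms that by (intro sets.Diff sets.finite_UN) auto
  then have "prob (\<Union>j\<in>S. first_at S E j \<inter> G j) = (\<Sum>j\<in>S. prob (first_at S E j \<inter> G j))"
    using disjoint_family_first_at[of S E] assms(1,3)
    by (intro finite_measure_finite_Union) (auto simp: disjoint_family_on_def)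
  then show ?thesis
    using assms(4) by simp
qed

end

section \<open>Multiplicative processes\<close>

locale cadlag_multiplicative_process =
  topological_group_on mul e invs + prob_space M
  for mul :: "'g::t2_space \<Rightarrow> 'g \<Rightarrow> 'g" and e :: 'g and invs :: "'g \<Rightarrow> 'g"
    and M :: "'w measure" +
  fixes F :: "real \<Rightarrow> real \<Rightarrow> 'w measure" and x :: "real \<Rightarrow> real \<Rightarrow> 'w \<Rightarrow> 'g"
  assumes filtration: "additive_filtration M F"
    and process: "multiplicative_process mul e invs M F x"
    and cadlag: "\<And>\<omega>. \<omega> \<in> space M \<Longrightarrow> cadlag_path (\<lambda>s t. x s t \<omega>)"
begin

section \<open>Adapted events, independence and the exceptional null set\<close>

lemma space_F: "0 \<le> s \<Longrightarrow> s \<le> t \<Longrightarrow> space (F s t) = space M"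
  using filtration by (auto simp: additive_filtration_def subalgebra_def)

lemma sets_F_events: "0 \<le> s \<Longrightarrow> s \<le> t \<Longrightarrow> A \<in> sets (F s t) \<Longrightarrow> A \<in> events"
  using filtration by (auto simp: additive_filtration_def subalgebra_def)

lemma sets_F_mono:
  assumes "0 \<le> s" "s \<le> t" "t \<le> u" "u \<le> v"
  shows "sets (F t u) \<subseteq> sets (F s v)"
proof -
  have "sets (F s t) \<subseteq> sets (F s t)" by simp
  then show ?thesis
    using filtration assms unfolding additive_filtration_def by blast
qed

lemma prob_Int_F:
  assumes "0 \<le> s" "s \<le> t" "t \<le> u" "A \<in> sets (F s t)" "B \<in> sets (F t u)"
  shows "prob (A \<inter> B) = prob A * prob B"
proof -
  have "indep_set (sets (F s t)) (sets (F t u))"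
    using filtration assms(1-3) unfolding additive_filtration_def by blast
  then show ?thesis
    using assms(4,5) by (rule indep_setD)
qed

lemma process_event_F:
  assumes "0 \<le> s" "s \<le> t" "B \<in> sets borel"
  shows "{\<omega> \<in> space M. x s t \<omega> \<in> B} \<in> sets (F s t)"
proof -
  have "x s t \<in> F s t \<rightarrow>\<^sub>M borel"
    using process assms(1,2) by (simp add: multiplicative_process_def)
  from measurable_sets[OF this assms(3)] show ?thesis
    using space_F[OF assms(1,2)] by (simp add: vimage_def Int_def conj_commute)
qed

lemma process_event:
  "0 \<le> s \<Longrightarrow> s \<le> t \<Longrightarrow> B \<in> sets borel \<Longrightarrow> {\<omega> \<in> space M. x s t \<omega> \<in> B} \<in> events"
  using process_event_F sets_F_events by blast

text \<open>The null set in the definition of the process depends on the three times. The countably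
  many rational triples share one, and right-continuity extends the identity to real times.\<close>

lemma AE_multiplicative:
  "AE \<omega> in M. \<forall>s t u. 0 \<le> s \<longrightarrow> s \<le> t \<longrightarrow> t \<le> u \<longrightarrow> mul (x s t \<omega>) (x t u \<omega>) = x s u \<omega>"
proof -
  have "AE \<omega> in M. \<forall>s\<in>\<rat>. \<forall>t\<in>\<rat>. \<forall>u\<in>\<rat>. 0 \<le> s \<longrightarrow> s \<le> t \<longrightarrow> t \<le> u \<longrightarrow>
      mul (x s t \<omega>) (x t u \<omega>) = x s u \<omega>"
    unfolding AE_ball_countable[OF countable_rat]
  proof (intro ballI)
    fix s t u :: real
    show "AE \<omega> in M. 0 \<le> s \<longrightarrow> s \<le> t \<longrightarrow> t \<le> u \<longrightarrow> mul (x s t \<omega>) (x t u \<omega>) = x s u \<omega>"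
      using process by (auto simp: multiplicative_process_def)
  qed
  then show ?thesis
  proof (rule AE_mp, intro AE_I2 impI allI)
    fix \<omega> and s t u :: real
    assume \<omega>: "\<omega> \<in> space M" and rat: "\<forall>s\<in>\<rat>. \<forall>t\<in>\<rat>. \<forall>u\<in>\<rat>. 0 \<le> s \<longrightarrow> s \<le> t \<longrightarrow> t \<le> u \<longrightarrow>
      mul (x s t \<omega>) (x t u \<omega>) = x s u \<omega>" and stu: "0 \<le> s" "s \<le> t" "t \<le> u"
    show "mul (x s t \<omega>) (x t u \<omega>) = x s u \<omega>"
      using rat by (intro multiplicative_if_rational[OF cadlag[OF \<omega>] _ stu]) blast
  qed
qed

section \<open>Stochastic continuity near the diagonal\<close>

lemma prob_increment_near_diag:
  assumes "0 \<le> s" and "open U" "e \<in> U" and "\<epsilon> > 0"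
  obtains d where "d > 0" "\<And>s' t'. 0 \<le> s' \<Longrightarrow> s' \<le> t' \<Longrightarrow> \<bar>s' - s\<bar> < d \<Longrightarrow> \<bar>t' - s\<bar> < d \<Longrightarrow>
    1 - \<epsilon> \<le> prob {\<omega> \<in> space M. x s' t' \<omega> \<in> U}"
proof -
  let ?Q = "\<lambda>h k. {\<omega> \<in> space M. mul (invs (x s s \<omega>)) (x (s + h) (s + k) \<omega>) \<in> U}"
  let ?D = "{(h, k). 0 \<le> s + h \<and> s + h \<le> s + k}"
  have xss: "AE \<omega> in M. x s s \<omega> = e"
    using process assms(1) by (auto simp: multiplicative_process_def)
  have "((\<lambda>(h, k). prob (?Q h k)) \<longlongrightarrow> 1) (at (0, 0) within ?D)"
    using process assms(1-3) unfolding multiplicative_process_def by blast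
  moreover have "max 0 (1 - \<epsilon>) < 1"
    using assms(4) by simp
  ultimately have "\<forall>\<^sub>F y in at (0, 0) within ?D. max 0 (1 - \<epsilon>) < (\<lambda>(h, k). prob (?Q h k)) y"
    by (rule order_tendstoD(1))
  then obtain d where d: "d > 0" "\<And>y. y \<in> ?D \<Longrightarrow> y \<noteq> (0, 0) \<Longrightarrow> dist y (0, 0) < d \<Longrightarrow>
      max 0 (1 - \<epsilon>) < (\<lambda>(h, k). prob (?Q h k)) y"
    unfolding eventually_at by blast
  show thesis
  proof
    show "d / 2 > 0"
      using d(1) by simp
    fix s' t' assume *: "0 \<le> s'" "s' \<le> t'" "\<bar>s' - s\<bar> < d / 2" "\<bar>t' - s\<bar> < d / 2"
    have ev: "{\<omega> \<in> space M. x s' t' \<omega> \<in> U} \<in> events"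
      using * assms(2) by (intro process_event) auto
    show "1 - \<epsilon> \<le> prob {\<omega> \<in> space M. x s' t' \<omega> \<in> U}"
    \<comment> \<open>The limit in stochastic continuity ignores the point itself, where the
      increment is almost surely \<open>e\<close>.\<close>
    proof (cases "s' = s \<and> t' = s")
      case True
      have "prob {\<omega> \<in> space M. x s' t' \<omega> \<in> U} = 1"
        using xss True ev assms(3) by (subst prob_eq_1) auto
      then show ?thesis
        using assms(4) by simp
    next
      case False
      have "dist (s' - s, t' - s) (0, 0) \<le> \<bar>s' - s\<bar> + \<bar>t' - s\<bar>"
        by (simp add: dist_Pair_Pair sqrt_sum_squares_le_sum_abs)
      then have "dist (s' - s, t' - s) (0, 0) < d"
        using * by linarith
      then have "max 0 (1 - \<epsilon>) < prob (?Q (s' - s) (t' - s))"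
        using d(2)[of "(s' - s, t' - s)"] * False by auto
      also have "\<dots> \<le> prob {\<omega> \<in> space M. x s' t' \<omega> \<in> U}"
      proof (rule finite_measure_mono_AE[OF _ ev])
        show "AE \<omega> in M. \<omega> \<in> ?Q (s' - s) (t' - s) \<longrightarrow> \<omega> \<in> {\<omega> \<in> space M. x s' t' \<omega> \<in> U}"
          using xss by eventually_elim auto
      qed
      finally show ?thesis by simp
    qed
  qed
qed

text \<open>Half a Lebesgue number of the cover of \<open>{0..b}\<close> by the intervals from
  \<open>prob_increment_near_diag\<close> works. Only \<open>s\<close> is bounded by
  \<open>b\<close>, since a window that starts before \<open>b\<close> may end after it.\<close>

lemma prob_increment_uniform:
  assumes "open U" "e \<in> U" and "\<epsilon> > 0"
  obtains \<eta> where "\<eta> > 0" "\<And>s t. 0 \<le> s \<Longrightarrow> s \<le> t \<Longrightarrow> s \<le> b \<Longrightarrow> t \<le> s + \<eta> \<Longrightarrow>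
    1 - \<epsilon> \<le> prob {\<omega> \<in> space M. x s t \<omega> \<in> U}"
proof -
  have "\<exists>d>0. \<forall>s' t'. 0 \<le> s' \<longrightarrow> s' \<le> t' \<longrightarrow> \<bar>s' - s\<bar> < d \<longrightarrow> \<bar>t' - s\<bar> < d \<longrightarrow>
      1 - \<epsilon> \<le> prob {\<omega> \<in> space M. x s' t' \<omega> \<in> U}" if s0: "0 \<le> s" for s
  proof -
    obtain d where "d > 0" "\<And>s' t'. 0 \<le> s' \<Longrightarrow> s' \<le> t' \<Longrightarrow> \<bar>s' - s\<bar> < d \<Longrightarrow> \<bar>t' - s\<bar> < d \<Longrightarrow>
        1 - \<epsilon> \<le> prob {\<omega> \<in> space M. x s' t' \<omega> \<in> U}"
      using prob_increment_near_diag[OF s0 assms] by blast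
    then show ?thesis by (intro exI[of _ d]) simp
  qed
  then have "\<forall>s\<in>{0..}. \<exists>d>0. \<forall>s' t'. 0 \<le> s' \<longrightarrow> s' \<le> t' \<longrightarrow> \<bar>s' - s\<bar> < d \<longrightarrow>
      \<bar>t' - s\<bar> < d \<longrightarrow> 1 - \<epsilon> \<le> prob {\<omega> \<in> space M. x s' t' \<omega> \<in> U}"
    by simp
  from bchoice[OF this] obtain d where d: "\<And>s. 0 \<le> s \<Longrightarrow> d s > 0"
    "\<And>s s' t'. 0 \<le> s \<Longrightarrow> 0 \<le> s' \<Longrightarrow> s' \<le> t' \<Longrightarrow> \<bar>s' - s\<bar> < d s \<Longrightarrow> \<bar>t' - s\<bar> < d s \<Longrightarrow>
      1 - \<epsilon> \<le> prob {\<omega> \<in> space M. x s' t' \<omega> \<in> U}"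
    by auto
  have "{0..b} \<subseteq> \<Union>((\<lambda>s. ball s (d s)) ` {0..b})"
    using d(1) by force
  then obtain \<eta> where \<eta>: "\<eta> > 0" "\<And>s. s \<in> {0..b} \<Longrightarrow> \<exists>G\<in>(\<lambda>s. ball s (d s)) ` {0..b}. ball s \<eta> \<subseteq> G"
    using Heine_Borel_lemma[of "{0..b}" "(\<lambda>s. ball s (d s)) ` {0..b}"] by blast
  show thesis
  proof
    show "\<eta> / 2 > 0"
      using \<eta>(1) by simp
    fix s t assume *: "0 \<le> s" "s \<le> t" "s \<le> b" "t \<le> s + \<eta> / 2"
    then obtain c where c: "c \<in> {0..b}" "ball s \<eta> \<subseteq> ball c (d c)"
      using \<eta>(2)[of s] by auto
    have "s \<in> ball s \<eta>" "t \<in> ball s \<eta>"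
      using * \<eta>(1) by (auto simp: dist_real_def)
    then have "s \<in> ball c (d c)" "t \<in> ball c (d c)"
      using c(2) by blast+
    then show "1 - \<epsilon> \<le> prob {\<omega> \<in> space M. x s t \<omega> \<in> U}"
      using c(1) * by (intro d(2)[of c]) (auto simp: dist_real_def)
  qed
qed

section \<open>Maximal inequalities\<close>

text \<open>Ottaviani's argument: after the first exit from \<open>W1\<close>, the remaining increment is likely to lie
  in \<open>W2\<close>, which keeps the process outside \<open>W2\<close> at time \<open>b\<close>.\<close>

lemma prob_exit_le:
  assumes "0 \<le> a" "a \<le> b" and T: "finite T" "T \<subseteq> {a..b}"
    and W: "open W1" "open W2" "\<And>g h. g \<in> W2 \<Longrightarrow> h \<in> W2 \<Longrightarrow> mul g (invs h) \<in> W1"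
    and \<epsilon>: "\<epsilon> \<le> 1 / 2"
    and small: "\<And>t. t \<in> insert a T \<Longrightarrow> 1 - \<epsilon> \<le> prob {\<omega> \<in> space M. x t b \<omega> \<in> W2}"
  shows "prob {\<omega> \<in> space M. \<exists>t\<in>T. x a t \<omega> \<notin> W1} \<le> 2 * \<epsilon>"
proof -
  define E where "E t = {\<omega> \<in> space M. x a t \<omega> \<in> - W1}" for t
  define G where "G t = {\<omega> \<in> space M. x t b \<omega> \<in> W2}" for t
  have T_bounds: "a \<le> t" "t \<le> b" "0 \<le> t" if "t \<in> T" for t
    using that T(2) assms(1) by auto
  have EF: "E t \<in> sets (F a t)" if "t \<in> T" for t
    unfolding E_def using T_bounds[OF that] assms(1) W(1) by (intro process_event_F) auto
  have GF: "G t \<in> sets (F t b)" if "t \<in> T" for t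
    unfolding G_def using T_bounds[OF that] W(2) by (intro process_event_F) auto
  have E_ev: "E t \<in> events" and G_ev: "G t \<in> events" if "t \<in> T" for t
    using EF[OF that] GF[OF that] T_bounds[OF that] assms(1) sets_F_events by blast+
  have firstF: "first_at T E t \<in> sets (F a t)" if "t \<in> T" for t
    unfolding first_at_def
  proof (intro sets.Diff sets.finite_UN EF that)
    show "E i \<in> sets (F a t)" if "i \<in> {i \<in> T. i < t}" for i
      using EF[of i] that T_bounds[of i] sets_F_mono[of a a i t] assms(1) by auto
  qed (use T(1) in simp)
  let ?P = "prob (\<Union>t\<in>T. E t)"
  have "(1 - \<epsilon>) * ?P = (\<Sum>t\<in>T. prob (first_at T E t) * (1 - \<epsilon>))"
    using prob_UN_first_at[OF T(1), of E] E_ev by (simp add: sum_distrib_left mult.commute)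
  also have "\<dots> \<le> (\<Sum>t\<in>T. prob (first_at T E t) * prob (G t))"
    using small by (intro sum_mono mult_left_mono) (auto simp: G_def)
  also have "\<dots> = prob (\<Union>t\<in>T. first_at T E t \<inter> G t)"
  proof (rule prob_UN_first_at_Int[OF T(1) E_ev G_ev, symmetric])
    show "prob (first_at T E t \<inter> G t) = prob (first_at T E t) * prob (G t)" if "t \<in> T" for t
      using assms(1) T_bounds[OF that] firstF[OF that] GF[OF that] by (intro prob_Int_F[of a t b])
  qed
  also have "\<dots> \<le> prob (space M - G a)"
  proof (rule finite_measure_mono_AE)
    show "space M - G a \<in> events"
      unfolding G_def using assms(1,2) W(2) by (intro sets.Diff process_event) auto
    show "AE \<omega> in M. \<omega> \<in> (\<Union>t\<in>T. first_at T E t \<inter> G t) \<longrightarrow> \<omega> \<in> space M - G a"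
      using AE_multiplicative
    proof (eventually_elim, intro impI)
      fix \<omega> assume mult: "\<forall>s t u. 0 \<le> s \<longrightarrow> s \<le> t \<longrightarrow> t \<le> u \<longrightarrow>
        mul (x s t \<omega>) (x t u \<omega>) = x s u \<omega>" and "\<omega> \<in> (\<Union>t\<in>T. first_at T E t \<inter> G t)"
      then obtain t where t: "t \<in> T" "\<omega> \<in> E t" "\<omega> \<in> G t"
        by (auto simp: first_at_def)
      have "mul (x a t \<omega>) (x t b \<omega>) = x a b \<omega>"
        using mult T_bounds[OF t(1)] assms(1) by simp
      then have "mul (x a b \<omega>) (invs (x t b \<omega>)) = x a t \<omega>"
        by (simp add: assoc flip: \<open>mul (x a t \<omega>) (x t b \<omega>) = x a b \<omega>\<close>)
      then show "\<omega> \<in> space M - G a"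
        using t(2,3) W(3)[of "x a b \<omega>" "x t b \<omega>"] by (auto simp: E_def G_def)
    qed
  qed
  \<comment> \<open>The time \<open>t = a\<close> in the smallness assumption bounds the whole
    increment from \<open>a\<close> to \<open>b\<close>; hence \<open>insert a T\<close>.\<close>
  also have "\<dots> \<le> \<epsilon>"
    using small[of a] assms(1,2) W(2) by (subst prob_compl) (auto simp: G_def intro!: process_event)
  finally have "?P \<le> \<epsilon> + \<epsilon> * ?P"
    by (simp add: algebra_simps)
  \<comment> \<open>At most half of \<open>?P\<close> remains on the right and can be absorbed,
    which produces the factor 2 in the bound.\<close>
  also have "\<epsilon> * ?P \<le> 1 / 2 * ?P"
    using \<epsilon> by (intro mult_right_mono) auto
  finally have "?P \<le> 2 * \<epsilon>" by simp
  also have "(\<Union>t\<in>T. E t) = {\<omega> \<in> space M. \<exists>t\<in>T. x a t \<omega> \<notin> W1}"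
    by (auto simp: E_def)
  finally show ?thesis .
qed

text \<open>An increment from \<open>i\<close> to \<open>j\<close> is a quotient of two increments
  that start at \<open>a\<close>, so it can only reach \<open>O'\<close> if one of these leaves
  \<open>W1\<close>.\<close>

lemma prob_oscillation_le:
  assumes "0 \<le> a" "a \<le> b" and T: "finite T" "T \<subseteq> {a..b}"
    and W: "open W1" "open W2" "\<And>g h. g \<in> W2 \<Longrightarrow> h \<in> W2 \<Longrightarrow> mul g (invs h) \<in> W1"
    and O: "\<And>g h. g \<in> W1 \<Longrightarrow> h \<in> W1 \<Longrightarrow> mul (invs g) h \<notin> O'"
    and \<epsilon>: "\<epsilon> \<le> 1 / 2"
    and small: "\<And>t. t \<in> insert a T \<Longrightarrow> 1 - \<epsilon> \<le> prob {\<omega> \<in> space M. x t b \<omega> \<in> W2}"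
  shows "prob {\<omega> \<in> space M. \<exists>i\<in>T. \<exists>j\<in>T. i < j \<and> x i j \<omega> \<in> O'} \<le> 2 * \<epsilon>"
proof -
  have "prob {\<omega> \<in> space M. \<exists>i\<in>T. \<exists>j\<in>T. i < j \<and> x i j \<omega> \<in> O'}
      \<le> prob {\<omega> \<in> space M. \<exists>t\<in>T. x a t \<omega> \<notin> W1}"
  proof (rule finite_measure_mono_AE)
    have "{\<omega> \<in> space M. \<exists>t\<in>T. x a t \<omega> \<notin> W1} = (\<Union>t\<in>T. {\<omega> \<in> space M. x a t \<omega> \<in> - W1})"
      by auto
    also have "\<dots> \<in> events"
      using T assms(1) W(1) by (intro sets.finite_UN process_event) auto
    finally show "{\<omega> \<in> space M. \<exists>t\<in>T. x a t \<omega> \<notin> W1} \<in> events" .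
    show "AE \<omega> in M. \<omega> \<in> {\<omega> \<in> space M. \<exists>i\<in>T. \<exists>j\<in>T. i < j \<and> x i j \<omega> \<in> O'} \<longrightarrow>
        \<omega> \<in> {\<omega> \<in> space M. \<exists>t\<in>T. x a t \<omega> \<notin> W1}"
      using AE_multiplicative
    proof (eventually_elim, intro impI)
      fix \<omega> assume mult: "\<forall>s t u. 0 \<le> s \<longrightarrow> s \<le> t \<longrightarrow> t \<le> u \<longrightarrow>
        mul (x s t \<omega>) (x t u \<omega>) = x s u \<omega>"
        and "\<omega> \<in> {\<omega> \<in> space M. \<exists>i\<in>T. \<exists>j\<in>T. i < j \<and> x i j \<omega> \<in> O'}"
      then obtain i j where ij: "\<omega> \<in> space M" "i \<in> T" "j \<in> T" "i < j" "x i j \<omega> \<in> O'"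
        by auto
      have "x a j \<omega> = mul (x a i \<omega>) (x i j \<omega>)"
        using mult ij T(2) assms(1) by (simp add: subset_iff)
      then have "mul (invs (x a i \<omega>)) (x a j \<omega>) = x i j \<omega>"
        by simp
      then show "\<omega> \<in> {\<omega> \<in> space M. \<exists>t\<in>T. x a t \<omega> \<notin> W1}"
        using O[of "x a i \<omega>" "x a j \<omega>"] ij by auto
    qed
  qed
  also have "\<dots> \<le> 2 * \<epsilon>"
    by (rule prob_exit_le[OF assms(1,2) T W \<epsilon> small])
  finally show ?thesis .
qed

section \<open>Geometric tail of the chain length\<close>

text \<open>Only increments after \<open>lo\<close> enter, and countably many of them. That the
  sigma-algebra starts at \<open>lo\<close> makes the remainder of a chain independent of the events
  before it.\<close>

lemma chain_event_F:
  assumes "countable T" "T \<subseteq> {..b}" and "open O'"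
  shows "0 \<le> lo \<Longrightarrow> lo \<le> b \<Longrightarrow>
    {\<omega> \<in> space M. chain (\<lambda>s t. x s t \<omega> \<in> O') T k lo} \<in> sets (F lo b)"
proof (induction k arbitrary: lo)
  case 0
  then show ?case
    using sets.top[of "F lo b"] space_F[of lo b] by simp
next
  case (Suc k)
  let ?I = "{i \<in> T. lo \<le> i}" and ?J = "\<lambda>i. {j \<in> T. i < j}"
  have "{\<omega> \<in> space M. chain (\<lambda>s t. x s t \<omega> \<in> O') T (Suc k) lo} =
      (\<Union>i\<in>?I. \<Union>j\<in>?J i. {\<omega> \<in> space M. x i j \<omega> \<in> O'} \<inter>
        {\<omega> \<in> space M. chain (\<lambda>s t. x s t \<omega> \<in> O') T k j})"
    by auto
  also have "\<dots> \<in> sets (F lo b)"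
  proof (intro sets.countable_UN'' sets.Int)
    show "countable ?I"
      by (rule countable_subset[OF _ assms(1)]) auto
    show "countable (?J i)" for i
      by (rule countable_subset[OF _ assms(1)]) auto
    fix i j assume ij: "i \<in> ?I" "j \<in> ?J i"
    then have le: "0 \<le> lo" "lo \<le> i" "i \<le> j" "j \<le> b"
      using assms(2) Suc.prems by auto
    have "{\<omega> \<in> space M. x i j \<omega> \<in> O'} \<in> sets (F i j)"
      using le assms(3) by (intro process_event_F) auto
    then show "{\<omega> \<in> space M. x i j \<omega> \<in> O'} \<in> sets (F lo b)"
      using sets_F_mono[OF le] by blast
    have "{\<omega> \<in> space M. chain (\<lambda>s t. x s t \<omega> \<in> O') T k j} \<in> sets (F j b)"
      using le by (intro Suc.IH) auto
    then show "{\<omega> \<in> space M. chain (\<lambda>s t. x s t \<omega> \<in> O') T k j} \<in> sets (F lo b)"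
      using sets_F_mono[of lo j b b] le by auto
  qed
  finally show ?case .
qed

lemma chain_event:
  assumes "countable T" "T \<subseteq> {..b}" and "open O'" and "0 \<le> lo" "lo \<le> b"
  shows "{\<omega> \<in> space M. chain (\<lambda>s t. x s t \<omega> \<in> O') T k lo} \<in> events"
  using chain_event_F[OF assms] assms(4,5) sets_F_events by blast

text \<open>A chain of length \<open>k + 1\<close> after \<open>lo\<close> either has its first interval completed before
  \<open>lo + \<eta>\<close>, and then a chain of length \<open>k\<close> follows independently, or it leaves a chain of
  length \<open>k\<close> after \<open>lo + \<eta>\<close>.\<close>

lemma prob_chain_Suc_le:
  assumes T: "finite T" "T \<subseteq> {..b}" and O: "open O'" and lo: "0 \<le> lo" "lo \<le> b" and "\<eta> > 0"
    and osc: "prob {\<omega> \<in> space M. \<exists>i\<in>T\<inter>{lo..lo+\<eta>}. \<exists>j\<in>T\<inter>{lo..lo+\<eta>}. i < j \<and> x i j \<omega> \<in> O'} \<le> \<rho>"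
    and IH: "\<And>j. lo \<le> j \<Longrightarrow> j \<le> b \<Longrightarrow>
      prob {\<omega> \<in> space M. chain (\<lambda>s t. x s t \<omega> \<in> O') T k j} \<le> c"
  shows "prob {\<omega> \<in> space M. chain (\<lambda>s t. x s t \<omega> \<in> O') T (Suc k) lo}
    \<le> \<rho> * c + prob {\<omega> \<in> space M. chain (\<lambda>s t. x s t \<omega> \<in> O') T k (lo + \<eta>)}"
proof -
  let ?C = "\<lambda>k j. {\<omega> \<in> space M. chain (\<lambda>s t. x s t \<omega> \<in> O') T k j}"
  \<comment> \<open>Possible ends of intervals inside the window; they exceed a start that is at
    least \<open>lo\<close>, so \<open>lo\<close> is excluded.\<close>
  define S where "S = T \<inter> {lo<..lo+\<eta>}"
  define E where "E j = (\<Union>i\<in>{i \<in> T. lo \<le> i \<and> i < j}. {\<omega> \<in> space M. x i j \<omega> \<in> O'})" for j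
  have S: "finite S"
    using T(1) by (simp add: S_def)
  have S_bounds: "lo \<le> j" "j \<le> b" "0 \<le> j" if "j \<in> S" for j
    using that T(2) lo(1) by (auto simp: S_def)
  have EF: "E j \<in> sets (F lo j)" if "j \<in> S" for j
    unfolding E_def
  proof (rule sets.finite_UN)
    show "finite {i \<in> T. lo \<le> i \<and> i < j}"
      using T(1) by simp
    fix i assume i: "i \<in> {i \<in> T. lo \<le> i \<and> i < j}"
    then have "{\<omega> \<in> space M. x i j \<omega> \<in> O'} \<in> sets (F i j)"
      using lo(1) O by (intro process_event_F) auto
    then show "{\<omega> \<in> space M. x i j \<omega> \<in> O'} \<in> sets (F lo j)"
      using sets_F_mono[of lo i j j] i lo(1) by auto
  qed
  have CF: "?C k j \<in> sets (F j b)" if "j \<in> S" for j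
    using S_bounds[OF that] countable_finite[OF T(1)] T(2) O by (intro chain_event_F) auto
  have E_ev: "E j \<in> events" and C_ev: "?C k j \<in> events" if "j \<in> S" for j
    using EF[OF that] CF[OF that] S_bounds[OF that] lo(1) sets_F_events by blast+
  have firstF: "first_at S E j \<in> sets (F lo j)" if "j \<in> S" for j
    unfolding first_at_def
  proof (intro sets.Diff sets.finite_UN EF that)
    show "E i \<in> sets (F lo j)" if "i \<in> {i \<in> S. i < j}" for i
      using EF[of i] that S_bounds[of i] sets_F_mono[of lo lo i j] lo(1) by auto
  qed (use S in simp)
  have first_ev: "first_at S E j \<in> events" if "j \<in> S" for j
    using firstF[OF that] S_bounds[OF that] lo(1) sets_F_events by blast
  have c: "0 \<le> c"
    using IH[OF lo(2)] measure_nonneg order_trans by blast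
  have "?C (Suc k) lo \<subseteq> (\<Union>j\<in>S. first_at S E j \<inter> ?C k j) \<union> ?C k (lo + \<eta>)"
  proof
    fix \<omega> assume "\<omega> \<in> ?C (Suc k) lo"
    then obtain i j where ij: "\<omega> \<in> space M" "i \<in> T" "j \<in> T" "lo \<le> i" "i < j" "x i j \<omega> \<in> O'"
      "chain (\<lambda>s t. x s t \<omega> \<in> O') T k j"
      by auto
    show "\<omega> \<in> (\<Union>j\<in>S. first_at S E j \<inter> ?C k j) \<union> ?C k (lo + \<eta>)"
    proof (cases "j \<le> lo + \<eta>")
      case True
      then have jS: "j \<in> S" and jE: "\<omega> \<in> E j"
        using ij by (auto simp: S_def E_def)
      then have "\<omega> \<in> (\<Union>j\<in>S. first_at S E j)"
        unfolding UN_first_at[OF S] by blast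
      then obtain j' where j': "j' \<in> S" "\<omega> \<in> first_at S E j'"
        by blast
      \<comment> \<open>The earliest completion may belong to an interval other than the given one.
        The chain after \<open>j\<close> is also a chain after the earlier
        \<open>j'\<close>.\<close>
      have "j' \<le> j"
      proof (rule ccontr)
        assume "\<not> j' \<le> j"
        then show False
          using j' jS jE by (auto simp: first_at_def)
      qed
      with ij(7) have "chain (\<lambda>s t. x s t \<omega> \<in> O') T k j'"
        by (rule chain_antimono)
      then show ?thesis
        using j' ij(1) by blast
    next
      case False
      then have "chain (\<lambda>s t. x s t \<omega> \<in> O') T k (lo + \<eta>)"
        using ij(7) chain_antimono by fastforce
      then show ?thesis
        using ij(1) by blast
    qed
  qed
  moreover have C_end: "?C k (lo + \<eta>) \<in> events"
  proof (rule chain_event)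
    \<comment> \<open>The window may end beyond \<open>b\<close>, so the upper time is
      enlarged.\<close>
    show "T \<subseteq> {..max b (lo + \<eta>)}"
      using T(2) by auto
  qed (use T O lo assms(6) in \<open>auto intro: countable_finite\<close>)
  moreover have U_ev: "(\<Union>j\<in>S. first_at S E j \<inter> ?C k j) \<in> events"
    using S first_ev C_ev by (intro sets.finite_UN sets.Int)
  ultimately have "prob (?C (Suc k) lo)
      \<le> prob ((\<Union>j\<in>S. first_at S E j \<inter> ?C k j) \<union> ?C k (lo + \<eta>))"
    by (intro finite_measure_mono sets.Un)
  also have "\<dots> \<le> prob (\<Union>j\<in>S. first_at S E j \<inter> ?C k j) + prob (?C k (lo + \<eta>))"
    using U_ev C_end by (rule measure_Un_le)
  also have "prob (\<Union>j\<in>S. first_at S E j \<inter> ?C k j) = (\<Sum>j\<in>S. prob (first_at S E j) * prob (?C k j))"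
    using S E_ev C_ev
  proof (rule prob_UN_first_at_Int)
    show "prob (first_at S E j \<inter> ?C k j) = prob (first_at S E j) * prob (?C k j)" if "j \<in> S" for j
      using lo(1) S_bounds[OF that] firstF[OF that] CF[OF that] by (intro prob_Int_F[of lo j b])
  qed
  also have "\<dots> \<le> (\<Sum>j\<in>S. prob (first_at S E j) * c)"
    using S_bounds IH by (intro sum_mono mult_left_mono) auto
  also have "\<dots> = prob (\<Union>j\<in>S. E j) * c"
    using prob_UN_first_at[OF S, of E] E_ev by (simp add: sum_distrib_right)
  \<comment> \<open>Some interval is completed within the window exactly if the path oscillates
    there, whose probability is at most \<open>\<rho>\<close>.\<close>
  also have "(\<Union>j\<in>S. E j) =
      {\<omega> \<in> space M. \<exists>i\<in>T\<inter>{lo..lo+\<eta>}. \<exists>j\<in>T\<inter>{lo..lo+\<eta>}. i < j \<and> x i j \<omega> \<in> O'}"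
    by (fastforce simp: S_def E_def)
  also have "prob \<dots> * c \<le> \<rho> * c"
    using osc c by (rule mult_right_mono)
  finally show ?thesis by simp
qed

text \<open>Here \<open>m\<close> windows cover the time from \<open>lo\<close> to \<open>b\<close>.
  With c(m, k) for the bound, the recursion reads c(m, k + 1) = \<rho> c(m, k) + c(m - 1, k), and
  both summands equal \<rho> c(m, k); this yields the ratio \<open>2 * \<rho>\<close>.\<close>

lemma prob_chain_le:
  assumes T: "finite T" "T \<subseteq> {..b}" and O: "open O'" and "\<eta> > 0" and \<rho>: "0 < \<rho>" "\<rho> \<le> 1"
    and osc: "\<And>lo. 0 \<le> lo \<Longrightarrow> lo \<le> b \<Longrightarrow>
      prob {\<omega> \<in> space M. \<exists>i\<in>T\<inter>{lo..lo+\<eta>}. \<exists>j\<in>T\<inter>{lo..lo+\<eta>}. i < j \<and> x i j \<omega> \<in> O'} \<le> \<rho>"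
  shows "0 \<le> lo \<Longrightarrow> b - lo \<le> real m * \<eta> \<Longrightarrow>
    prob {\<omega> \<in> space M. chain (\<lambda>s t. x s t \<omega> \<in> O') T k lo} \<le> (1 / \<rho>) ^ m * (2 * \<rho>) ^ k"
proof (induction k arbitrary: lo m)
  case 0
  have "1 \<le> (1 / \<rho>) ^ m"
    using \<rho> by (intro one_le_power) simp
  then show ?case
    by (simp add: prob_space)
next
  case (Suc k)
  show ?case
  proof (cases "lo < b")
    case False
    then have "{\<omega> \<in> space M. chain (\<lambda>s t. x s t \<omega> \<in> O') T (Suc k) lo} = {}"
      using T(2) by fastforce
    then have "prob {\<omega> \<in> space M. chain (\<lambda>s t. x s t \<omega> \<in> O') T (Suc k) lo} = 0"
      by (simp only: measure_empty)
    then show ?thesis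
      using \<rho> by simp
  next
    case True
    then obtain m' where m: "m = Suc m'"
      using Suc.prems by (cases m) auto
    have "prob {\<omega> \<in> space M. chain (\<lambda>s t. x s t \<omega> \<in> O') T (Suc k) lo}
      \<le> \<rho> * ((1 / \<rho>) ^ m * (2 * \<rho>) ^ k)
        + prob {\<omega> \<in> space M. chain (\<lambda>s t. x s t \<omega> \<in> O') T k (lo + \<eta>)}"
      using Suc.prems True by (intro prob_chain_Suc_le[where b = b] T O assms(4) osc Suc.IH) auto
    also have "\<dots> \<le> \<rho> * ((1 / \<rho>) ^ m * (2 * \<rho>) ^ k) + (1 / \<rho>) ^ m' * (2 * \<rho>) ^ k"
      using Suc.prems assms(4) by (intro add_left_mono Suc.IH) (auto simp: m algebra_simps)
    also have "\<dots> = (1 / \<rho>) ^ m * (2 * \<rho>) ^ Suc k"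
      using \<rho> by (simp add: m field_simps)
    finally show ?thesis .
  qed
qed

text \<open>A chain uses finitely many times, so the event is an increasing union of those for
  finite subsets, and continuity from below preserves the uniform bound.\<close>

lemma prob_chain_countable_le:
  assumes T: "countable T" "T \<subseteq> {..b}" and O: "open O'" and lo: "0 \<le> lo" "lo \<le> b"
    and le: "\<And>T'. finite T' \<Longrightarrow> T' \<subseteq> T \<Longrightarrow>
      prob {\<omega> \<in> space M. chain (\<lambda>s t. x s t \<omega> \<in> O') T' k lo} \<le> c"
  shows "prob {\<omega> \<in> space M. chain (\<lambda>s t. x s t \<omega> \<in> O') T k lo} \<le> c"
proof (cases "finite T")
  case True
  then show ?thesis by (intro le) auto
next
  case False
  define T' where "T' n = from_nat_into T ` {..n}" for n
  let ?C = "\<lambda>T. {\<omega> \<in> space M. chain (\<lambda>s t. x s t \<omega> \<in> O') T k lo}"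
  have T': "finite (T' n)" "T' n \<subseteq> T" for n
    using False by (auto simp: T'_def intro!: from_nat_into)
  have sub: "\<exists>n. T'' \<subseteq> T' n" if "finite T''" "T'' \<subseteq> T" for T''
  proof -
    have "T'' \<subseteq> T' (Max (to_nat_on T ` T''))"
    proof
      fix t assume "t \<in> T''"
      then show "t \<in> T' (Max (to_nat_on T ` T''))"
        using that T(1) unfolding T'_def
        by (intro image_eqI[of _ _ "to_nat_on T t"]) (auto simp: from_nat_into_to_nat_on subset_iff)
    qed
    then show ?thesis ..
  qed
  have "incseq (\<lambda>n. ?C (T' n))"
    unfolding incseq_def
  proof (intro allI impI subsetI)
    fix n n' :: nat and \<omega> assume "n \<le> n'" "\<omega> \<in> ?C (T' n)"
    then show "\<omega> \<in> ?C (T' n')"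
      using chain_mono[of _ "T' n" k lo "T' n'"] by (force simp: T'_def)
  qed
  moreover have "range (\<lambda>n. ?C (T' n)) \<subseteq> events"
    using T' T(2) O lo by (auto intro!: chain_event[of _ b] countable_finite)
  ultimately have "(\<lambda>n. prob (?C (T' n))) \<longlonglongrightarrow> prob (\<Union>n. ?C (T' n))"
    by (intro finite_Lim_measure_incseq)
  then have "prob (\<Union>n. ?C (T' n)) \<le> c"
    using le T' by (intro LIMSEQ_le_const2) auto
  also have "(\<Union>n. ?C (T' n)) = ?C T"
  proof
    show "(\<Union>n. ?C (T' n)) \<subseteq> ?C T"
      using chain_mono[OF _ T'(2)] by auto
    show "?C T \<subseteq> (\<Union>n. ?C (T' n))"
    proof
      fix \<omega> assume \<omega>: "\<omega> \<in> ?C T"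
      then have "chain (\<lambda>s t. x s t \<omega> \<in> O') T k lo"
        by simp
      from chain_finite_subset[OF this] obtain T'' where T'': "finite T''" "T'' \<subseteq> T"
        "chain (\<lambda>s t. x s t \<omega> \<in> O') T'' k lo"
        by blast
      obtain n where "T'' \<subseteq> T' n"
        using sub[OF T''(1,2)] by blast
      then have "chain (\<lambda>s t. x s t \<omega> \<in> O') (T' n) k lo"
        using T''(3) chain_mono by blast
      then show "\<omega> \<in> (\<Union>n. ?C (T' n))"
        using \<omega> by blast
    qed
  qed
  finally show ?thesis .
qed

end

section \<open>Exponential moments\<close>

context cadlag_multiplicative_process
begin

text \<open>The constant may depend on \<open>\<rho>\<close>, but neither on \<open>T\<close> nor on
  \<open>k\<close>; this lets the ratio be chosen in advance to beat any exponential weight.\<close>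

lemma prob_chain_geometric:
  assumes K: "closed K" "open W" "e \<in> W" "W \<subseteq> K" and "0 \<le> a" "a \<le> b" and \<rho>: "0 < \<rho>" "\<rho> \<le> 1"
  obtains C where "C \<ge> 0"
    "\<And>T k. countable T \<Longrightarrow> T \<subseteq> {..b} \<Longrightarrow>
      prob {\<omega> \<in> space M. chain (\<lambda>s t. x s t \<omega> \<in> - K) T k a} \<le> C * (2 * \<rho>) ^ k"
proof -
  obtain W1 where W1: "open W1" "e \<in> W1" "\<And>g. g \<in> W1 \<Longrightarrow> invs g \<in> W1"
    "\<And>g h. g \<in> W1 \<Longrightarrow> h \<in> W1 \<Longrightarrow> mul g h \<in> W"
    using ex_symmetric_nbhd[OF K(2,3)] by blast
  obtain W2 where W2: "open W2" "e \<in> W2" "\<And>g. g \<in> W2 \<Longrightarrow> invs g \<in> W2"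
    "\<And>g h. g \<in> W2 \<Longrightarrow> h \<in> W2 \<Longrightarrow> mul g h \<in> W1"
    using ex_symmetric_nbhd[OF W1(1,2)] by blast
  \<comment> \<open>The maximal inequality doubles the error, hence
    \<open>\<rho> / 2\<close>.\<close>
  obtain \<eta> where \<eta>: "\<eta> > 0" "\<And>s t. 0 \<le> s \<Longrightarrow> s \<le> t \<Longrightarrow> s \<le> b \<Longrightarrow> t \<le> s + \<eta> \<Longrightarrow>
      1 - \<rho> / 2 \<le> prob {\<omega> \<in> space M. x s t \<omega> \<in> W2}"
    using prob_increment_uniform[OF W2(1,2), of "\<rho> / 2" b] \<rho>(1) by auto
  have osc: "prob {\<omega> \<in> space M. \<exists>i\<in>T\<inter>{lo..lo+\<eta>}. \<exists>j\<in>T\<inter>{lo..lo+\<eta>}. i < j \<and> x i j \<omega> \<in> - K} \<le> \<rho>"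
    if "finite T" "T \<subseteq> {..b}" "0 \<le> lo" "lo \<le> b" for T lo
  proof -
    have "prob {\<omega> \<in> space M. \<exists>i\<in>T\<inter>{lo..lo+\<eta>}. \<exists>j\<in>T\<inter>{lo..lo+\<eta>}. i < j \<and> x i j \<omega> \<in> - K} \<le> 2 * (\<rho> / 2)"
    proof (rule prob_oscillation_le[where b = "lo + \<eta>" and a = lo, OF _ _ _ _ W1(1) W2(1)])
      show "1 - \<rho> / 2 \<le> prob {\<omega> \<in> space M. x t (lo + \<eta>) \<omega> \<in> W2}" if "t \<in> insert lo (T \<inter> {lo..lo+\<eta>})" for t
        using that \<open>0 \<le> lo\<close> \<open>lo \<le> b\<close> \<open>T \<subseteq> {..b}\<close> \<eta>(1) by (intro \<eta>(2)) auto
      show "mul (invs g) h \<notin> - K" if "g \<in> W1" "h \<in> W1" for g h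
        using that W1(3,4) K(4) by blast
    qed (use that \<eta>(1) \<rho>(2) W2(3,4) in auto)
    then show ?thesis by simp
  qed
  obtain m :: nat where m: "(b - a) / \<eta> \<le> real m"
    using real_arch_simple by blast
  have *: "prob {\<omega> \<in> space M. chain (\<lambda>s t. x s t \<omega> \<in> - K) T k a} \<le> (1 / \<rho>) ^ m * (2 * \<rho>) ^ k"
    if "finite T" "T \<subseteq> {..b}" for T k
    using m \<eta>(1) K(1) that assms(5)
    by (intro prob_chain_le[where b = b and \<eta> = \<eta>] osc \<rho>) (auto simp: field_simps)
  show thesis
  proof
    show "0 \<le> (1 / \<rho>) ^ m"
      using \<rho> by simp
    show "prob {\<omega> \<in> space M. chain (\<lambda>s t. x s t \<omega> \<in> - K) T k a} \<le> (1 / \<rho>) ^ m * (2 * \<rho>) ^ k"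
      if "countable T" "T \<subseteq> {..b}" for T k
      using that(2) by (intro prob_chain_countable_le[OF that] * assms(5,6)) (use K(1) in auto)
  qed
qed

text \<open>The majorant \<open>g\<close> is built from chains at rational times and is therefore
  measurable, while the conclusion holds for all real times. The value \<open>\<infinity>\<close>
  covers paths with chains of every length.\<close>

lemma ex_exponential_majorant:
  assumes V: "open V" "e \<in> V" and "0 \<le> a" "a \<le> b" and "0 \<le> \<beta>"
    and jumps: "AE \<omega> in M. \<forall>t\<ge>0. jump e (\<lambda>s t. x s t \<omega>) t \<in> set_pow mul e V p"
  obtains g where "g \<in> borel_measurable M" "(\<integral>\<^sup>+\<omega>. g \<omega> \<partial>M) < \<infinity>"
    "AE \<omega> in M. g \<omega> = \<infinity> \<or> (\<exists>k. \<forall>s t. a \<le> s \<longrightarrow> s \<le> t \<longrightarrow> t < b \<longrightarrow>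
      x s t \<omega> \<in> set_pow mul e V (k * (p + 2)) \<and> ennreal (exp (\<beta> * real k)) \<le> g \<omega>)"
proof -
  obtain W where W: "open W" "e \<in> W" "closure W \<subseteq> V"
    using ex_closed_nbhd[OF V] by blast
  define K where "K = closure W"
  \<comment> \<open>Chosen so that \<open>exp \<beta> * (2 * \<rho>) = 1 / 2\<close>: the weighted
    tail is summable.\<close>
  define \<rho> where "\<rho> = exp (- \<beta>) / 4"
  have \<rho>: "0 < \<rho>" "\<rho> \<le> 1"
  proof -
    have "exp (- \<beta>) \<le> 1"
      using assms(5) by simp
    then have "exp (- \<beta>) / 4 \<le> 1"
      by linarith
    then show "0 < \<rho>" "\<rho> \<le> 1"
      unfolding \<rho>_def by simp_all
  qed
  obtain C where C: "C \<ge> 0" "\<And>T k. countable T \<Longrightarrow> T \<subseteq> {..b} \<Longrightarrow>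
      prob {\<omega> \<in> space M. chain (\<lambda>s t. x s t \<omega> \<in> - K) T k a} \<le> C * (2 * \<rho>) ^ k"
    using prob_chain_geometric[of K W a b \<rho>] W closure_subset[of W] assms(3,4) \<rho>
    by (auto simp: K_def)
  define Q where "Q = {a..<b} \<inter> \<rat>"
  define R where "R k = {\<omega> \<in> space M. chain (\<lambda>s t. x s t \<omega> \<in> - K) Q k a}" for k
  have Q: "countable Q" "Q \<subseteq> {..b}"
    using countable_rat by (auto simp: Q_def)
  have R_ev: "R k \<in> events" for k
    unfolding R_def using assms(3,4) by (intro chain_event[OF Q]) (simp_all add: K_def open_Compl)
  have R_le: "prob (R k) \<le> C * (2 * \<rho>) ^ k" for k
    unfolding R_def by (rule C(2)[OF Q])
  \<comment> \<open>The weight is shifted by one: if \<open>k\<close> is the least length without a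
    chain, only \<open>R (k - 1)\<close> is known to contain \<open>\<omega>\<close>, and its term
    must already be \<open>exp (\<beta> * real k)\<close>.\<close>
  define g where "g \<omega> = (\<Sum>k. ennreal (exp (\<beta> * real (Suc k))) * indicator (R k) \<omega>)" for \<omega>
  show thesis
  proof
    show "g \<in> borel_measurable M"
      unfolding g_def using R_ev by measurable
    have term_le: "exp (\<beta> * real (Suc k)) * prob (R k) \<le> exp \<beta> * C * (1 / 2) ^ k" for k
    proof -
      have "exp (\<beta> * real (Suc k)) * prob (R k) \<le> exp (\<beta> * real (Suc k)) * (C * (2 * \<rho>) ^ k)"
        by (intro mult_left_mono R_le) simp
      also have "\<dots> = exp \<beta> * C * (exp \<beta> * (2 * \<rho>)) ^ k"
        by (simp add: exp_add exp_of_nat2_mult power_mult_distrib distrib_left)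
      also have "exp \<beta> * (2 * \<rho>) = 1 / 2"
        by (simp add: \<rho>_def exp_minus)
      finally show ?thesis .
    qed
    have "(\<integral>\<^sup>+\<omega>. g \<omega> \<partial>M) = (\<Sum>k. \<integral>\<^sup>+\<omega>. ennreal (exp (\<beta> * real (Suc k))) * indicator (R k) \<omega> \<partial>M)"
      unfolding g_def using R_ev by (intro nn_integral_suminf borel_measurable_times borel_measurable_indicator) auto
    also have "\<dots> = (\<Sum>k. ennreal (exp (\<beta> * real (Suc k)) * prob (R k)))"
      using R_ev by (simp add: nn_integral_cmult_indicator emeasure_eq_measure ennreal_mult)
    also have "\<dots> \<le> (\<Sum>k. ennreal (exp \<beta> * C * (1 / 2) ^ k))"
      by (intro suminf_le ennreal_leI term_le) auto
    also have "\<dots> = ennreal (\<Sum>k. exp \<beta> * C * (1 / 2) ^ k)"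
      using C(1) by (intro suminf_ennreal2 summable_mult summable_geometric) auto
    also have "\<dots> < \<infinity>"
      by simp
    finally show "(\<integral>\<^sup>+\<omega>. g \<omega> \<partial>M) < \<infinity>" .
    have g_ge: "ennreal (exp (\<beta> * real (Suc k))) \<le> g \<omega>" if "\<omega> \<in> R k" for k \<omega>
    proof -
      have "(\<Sum>k\<in>{k}. ennreal (exp (\<beta> * real (Suc k))) * indicator (R k) \<omega>) \<le> g \<omega>"
        unfolding g_def by (intro sum_le_suminf) auto
      then show ?thesis
        using that by simp
    qed
    show "AE \<omega> in M. g \<omega> = \<infinity> \<or> (\<exists>k. \<forall>s t. a \<le> s \<longrightarrow> s \<le> t \<longrightarrow> t < b \<longrightarrow>
        x s t \<omega> \<in> set_pow mul e V (k * (p + 2)) \<and> ennreal (exp (\<beta> * real k)) \<le> g \<omega>)"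
      using AE_multiplicative jumps AE_space
    proof eventually_elim
      case (elim \<omega>)
      let ?f = "\<lambda>s t. x s t \<omega>"
      have real_to_R: "\<omega> \<in> R k" if "chain (\<lambda>s t. ?f s t \<notin> K) {a..<b} k a" for k
      proof -
        have "chain (\<lambda>s t. ?f s t \<in> - K) {a..<b} k a"
          using that by simp
        then obtain lo where "lo > a" "chain (\<lambda>s t. ?f s t \<in> - K) Q k lo"
          using chain_open_rational[OF cadlag[OF elim(3)], of "- K" a] assms(3)
          unfolding Q_def K_def by blast
        then show ?thesis
          using chain_antimono[of _ Q k lo a] elim(3) by (simp add: R_def)
      qed
      show ?case
      proof (cases "\<forall>k. chain (\<lambda>s t. ?f s t \<notin> K) {a..<b} k a")
        case True
        \<comment> \<open>All events \<open>R k\<close> occur, and each weight is at least 1 because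
          \<open>\<beta>\<close> is nonnegative.\<close>
        have "of_nat n \<le> g \<omega>" for n
        proof -
          have "of_nat n = (\<Sum>k<n. 1 :: ennreal)"
            by simp
          also have "\<dots> \<le> (\<Sum>k<n. ennreal (exp (\<beta> * real (Suc k))) * indicator (R k) \<omega>)"
            using True real_to_R assms(5) by (intro sum_mono) simp
          also have "\<dots> \<le> g \<omega>"
            unfolding g_def by (intro sum_le_suminf) auto
          finally show ?thesis .
        qed
        then have "g \<omega> = \<infinity>"
          using ennreal_Ex_less_of_nat[of "g \<omega>"] by (auto simp flip: not_less top.not_eq_extremum)
        then show ?thesis ..
      next
        case False
        define k where "k = (LEAST k. \<not> chain (\<lambda>s t. ?f s t \<notin> K) {a..<b} k a)"
        have k: "\<not> chain (\<lambda>s t. ?f s t \<notin> K) {a..<b} k a"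
          unfolding k_def by (rule LeastI_ex) (use False in blast)
        then obtain k' where k': "k = Suc k'"
          by (cases k) auto
        have "chain (\<lambda>s t. ?f s t \<notin> K) {a..<b} k' a"
          using not_less_Least[of k' "\<lambda>k. \<not> chain (\<lambda>s t. ?f s t \<notin> K) {a..<b} k a"] k'
          by (auto simp: k_def)
        then have ge: "ennreal (exp (\<beta> * real k)) \<le> g \<omega>"
          using g_ge[OF real_to_R] by (simp add: k')
        have "x s t \<omega> \<in> set_pow mul e V (k * (p + 2))" if st: "a \<le> s" "s \<le> t" "t < b" for s t
        proof (rule mem_set_pow_if_not_chain[where f = ?f and K = K and a = a and b = b])
          show "\<not> chain (\<lambda>s t. ?f s t \<notin> K) {a..<b} k s"
            using k chain_antimono st(1) by blast
        qed (use elim st W(3) V assms(3) cadlag in \<open>auto simp: K_def\<close>)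
        then show ?thesis
          using ge by blast
      qed
    qed
  qed
qed

end

section \<open>The bound for the power index\<close>

lemma exp_ereal_le: "a \<le> ereal c \<Longrightarrow> exp_ereal a \<le> ennreal (exp c)"
  by (cases a) (auto simp: exp_ereal_def intro: ennreal_leI)

theorem theorem4p2:
  fixes mul :: "'g::t2_space \<Rightarrow> 'g \<Rightarrow> 'g" and e :: 'g and invs :: "'g \<Rightarrow> 'g"
    and A :: "('g, 'a::banach) charts" and E :: "'g set" and \<theta> :: "'g \<Rightarrow> 'a"
    and expG :: "'a \<Rightarrow> 'g" and Ug :: "'a set" and UG :: "'g set"
    and M :: "'w measure" and F :: "real \<Rightarrow> real \<Rightarrow> 'w measure"
    and x :: "real \<Rightarrow> real \<Rightarrow> 'w \<Rightarrow> 'g"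
    and r u \<alpha> :: real and V :: "'g set"
  assumes "banach_lie_group_exp mul e invs A E \<theta> expG Ug UG"
    and "separable_space (euclidean :: 'g topology)"
    and "prob_space M" and "complete_measure M"
    and "additive_filtration M F" and "usual_hypotheses M F"
    and "multiplicative_process mul e invs M F x"
    and "\<And>\<omega>. \<omega> \<in> space M \<Longrightarrow> cadlag_path (\<lambda>s t. x s t \<omega>)"
    and "bounded_jumps mul e expG UG M x"
    and "0 < r" and "r < u"
    and "open V" and "e \<in> V"
  shows "upper_expectation M
           (\<lambda>\<omega>. SUP (s, t)\<in>{(s, t). r \<le> s \<and> s \<le> t \<and> t \<le> u}.
                   exp_ereal (ereal \<alpha> * power_index mul e V (x s t \<omega>))) < \<infinity>"
proof -
  interpret banach_lie_group_exp mul e invs A E \<theta> expG Ug UG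
    by (rule assms(1))
  interpret prob_space M
    by (rule assms(3))
  interpret cadlag_multiplicative_process mul e invs M F x
    using assms(5,7,8) by unfold_locales
  obtain \<delta> n where n: "AE \<omega> in M. \<forall>t\<ge>0. jump e (\<lambda>s t. x s t \<omega>) t \<in> set_pow mul e (expG ` ball 0 \<delta>) n"
    using assms(9) by (auto simp: bounded_jumps_def)
  obtain k where k: "expG ` ball 0 \<delta> \<subseteq> set_pow mul e V k"
    using exp_ball_subset_set_pow[OF assms(12,13)] by blast
  define p where "p = k * n"
  \<comment> \<open>The power index is nonnegative, so a negative \<open>\<alpha>\<close> is
    dominated by 0; monotonicity then applies.\<close>
  define \<alpha>' where "\<alpha>' = max 0 \<alpha>"
  have \<alpha>': "0 \<le> \<alpha>'" "\<alpha> \<le> \<alpha>'"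
    by (simp_all add: \<alpha>'_def)
  have jumps: "AE \<omega> in M. \<forall>t\<ge>0. jump e (\<lambda>s t. x s t \<omega>) t \<in> set_pow mul e V p"
    using n by eventually_elim (use k in \<open>auto simp: p_def intro: set_pow_set_pow\<close>)
  \<comment> \<open>Each counted interval costs \<open>p + 2\<close> factors from
    \<open>V\<close>.\<close>
  define \<beta> where "\<beta> = \<alpha>' * real (p + 2)"
  \<comment> \<open>The majorant covers times strictly below its upper end; \<open>u + 1\<close>
    includes \<open>t = u\<close>.\<close>
  let ?P = "\<lambda>g \<omega>. g \<omega> = (\<infinity> :: ennreal) \<or> (\<exists>k. \<forall>s t. r \<le> s \<longrightarrow> s \<le> t \<longrightarrow> t < u + 1 \<longrightarrow>
      x s t \<omega> \<in> set_pow mul e V (k * (p + 2)) \<and> ennreal (exp (\<beta> * real k)) \<le> g \<omega>)"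
  have "0 \<le> r" "r \<le> u + 1" "0 \<le> \<beta>"
    using assms(10,11) by (simp_all add: \<beta>_def \<alpha>')
  then obtain g where g: "g \<in> borel_measurable M" "(\<integral>\<^sup>+\<omega>. g \<omega> \<partial>M) < \<infinity>" "AE \<omega> in M. ?P g \<omega>"
    using ex_exponential_majorant[OF assms(12,13) _ _ _ jumps] by blast
  obtain N where N: "{\<omega> \<in> space M. \<not> ?P g \<omega>} \<subseteq> N" "N \<in> null_sets M"
    using g(3) by (auto elim!: AE_E simp: null_sets_def)
  \<comment> \<open>The upper expectation asks for a majorant at every \<open>\<omega>\<close>, so
    the almost sure bound is made everywhere valid by the value \<open>\<infinity>\<close> on
    \<open>N\<close>, without changing the integral.\<close>
  define h where "h \<omega> = g \<omega> + \<infinity> * indicator N \<omega>" for \<omega>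
  have h_meas: "h \<in> borel_measurable M"
    unfolding h_def using g(1) null_setsD2[OF N(2)] by measurable
  have "AE \<omega> in M. h \<omega> = g \<omega>"
    using AE_not_in[OF N(2)] by eventually_elim (simp add: h_def)
  then have "(\<integral>\<^sup>+\<omega>. h \<omega> \<partial>M) = (\<integral>\<^sup>+\<omega>. g \<omega> \<partial>M)"
    by (rule nn_integral_cong_AE)
  then have h_fin: "(\<integral>\<^sup>+\<omega>. h \<omega> \<partial>M) < \<infinity>"
    using g(2) by simp
  have exp_le: "exp_ereal (ereal \<alpha> * power_index mul e V (x s t \<omega>)) \<le> h \<omega>"
    if \<omega>: "\<omega> \<in> space M" and st: "r \<le> s" "s \<le> t" "t \<le> u" for s t \<omega>
  proof (cases "\<omega> \<in> N \<or> g \<omega> = \<infinity>")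
    case True
    then have "h \<omega> = \<infinity>"
      by (auto simp: h_def)
    then show ?thesis by simp
  next
    case False
    then obtain k where k: "x s t \<omega> \<in> set_pow mul e V (k * (p + 2))" "ennreal (exp (\<beta> * real k)) \<le> g \<omega>"
      using N(1) \<omega> st by fastforce
    have "power_index mul e V (x s t \<omega>) \<le> ereal (real (k * (p + 2)))"
      unfolding power_index_def using k(1) by (intro INF_lower) simp
    then have "ereal \<alpha>' * power_index mul e V (x s t \<omega>) \<le> ereal \<alpha>' * ereal (real (k * (p + 2)))"
      by (intro ereal_mult_left_mono) (simp_all add: \<alpha>')
    moreover have "0 \<le> power_index mul e V (x s t \<omega>)"
      unfolding power_index_def by (intro INF_greatest) simp
    then have "ereal \<alpha> * power_index mul e V (x s t \<omega>) \<le> ereal \<alpha>' * power_index mul e V (x s t \<omega>)"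
      by (intro ereal_mult_right_mono) (simp_all add: \<alpha>')
    ultimately have "ereal \<alpha> * power_index mul e V (x s t \<omega>) \<le> ereal (\<beta> * real k)"
      by (simp add: \<beta>_def algebra_simps)
    then have "exp_ereal (ereal \<alpha> * power_index mul e V (x s t \<omega>)) \<le> ennreal (exp (\<beta> * real k))"
      by (rule exp_ereal_le)
    also have "\<dots> \<le> h \<omega>"
      using k(2) by (simp add: h_def add_increasing2)
    finally show ?thesis .
  qed
  have "upper_expectation M
           (\<lambda>\<omega>. SUP (s, t)\<in>{(s, t). r \<le> s \<and> s \<le> t \<and> t \<le> u}.
                   exp_ereal (ereal \<alpha> * power_index mul e V (x s t \<omega>))) \<le> (\<integral>\<^sup>+\<omega>. h \<omega> \<partial>M)"
    unfolding upper_expectation_def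
    by (intro INF_lower CollectI conjI h_meas ballI SUP_least) (auto intro: exp_le)
  then show ?thesis
    using h_fin by (rule le_less_trans)
qed

end
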